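(* Let $f:\{0,1\}^n\to\{0,1\}$ and $g:\{0,1\}^m\to\{0,1\}$ be Boolean functions, let $p\in[0,1]$, and set $g(p):=\mathbb P_{x\sim\pi_p}[g(x)=1]$. Then (i) $s(f\circ g,\pi_p)=s(f,\pi_{g(p)})\cdot s(g,\pi_p)$, (ii) $\ell(f\circ g,\pi_p)\le \ell(f,\pi_{g(p)})\cdot\ell(g,\pi_p)$, (iii) $sc(f\circ g,\pi_p)\le sc(f,\pi_{g(p)})\cdot sc(g,\pi_p)$, (iv) $a(f\circ g,\pi_p)\le a(f,\pi_{g(p)})\cdot a(g,\pi_p)$.
   Context: The composition $f\circ g$ is the Boolean function on $n\cdot m$ bits given by $f\circ g(x^1_1,\dots,x^1_m,\dots,x^n_1,\dots,x^n_m)=f(g(x^1_1,\dots,x^1_m),\dots,g(x^n_1,\dots,x^n_m))$. For a number of bits $N$, $[N]=\{1,\dots,N\}$, and $\pi_q$ is the product measure on $\{0,1\}^N$ under which each bit is $1$ with probability $q$. For a Boolean function $h$ on $N$ bits and $W\subseteq[N]$, $x|_W$ "determines $h$" if $h$ is constant on $\{y:y|_W=x|_W\}$. - $s(h,\pi_q)=\mathbb E_{x\sim\pi_q}[s_h(x)]$, where $s_h(x)$ is the number of bits $i$ such that flipping bit $i$ in $x$ changes the value of $h$. - $\ell(h,\pi_q)$: consider random sets $\mathcal I\subseteq[N]$ defined on the same probability space as $x\sim\pi_q$ (not necessarily measurable with respect to $x$; the probability space is arbitrary). $\mathcal I$ is a witness set for $h$ if $x|_{\mathcal I}$ almost surely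 determines $h$. $\mathcal I$ is local if for every fixed $J\subseteq[N]$, $\sigma(\{\mathcal I=J\},(x_i:i\in J))$ is independent of $\sigma(x_i:i\notin J)$. $\ell(h,\pi_q)$ is the minimum of $\mathbb E[|\mathcal I|]$ over all local witness sets $\mathcal I$ for $h$. - $sc(h,\pi_q)=\min_{\mathcal C\sim h}\mathbb E_{x\sim\pi_q}[c(\mathcal C,x)]$, where $\mathcal C$ ranges over partitions of $\{0,1\}^N$ into subcubes (sets obtained by fixing the values of some set of bits) such that $h$ is constant on each subcube of $\mathcal C$, and $c(\mathcal C,x)$ is the number of bits fixed by the subcube of $\mathcal C$ containing $x$. - $a(h,\pi_q)=\min_A\mathbb E_{x\sim\pi_q}[c_h(A,x)]$, where an algorithm $A$ queries the bits one by one, the next queried bit being allowed to depend on the outcomes of all previous queries, and $c_h(A,x)$ is the number of queries made by $A$ on $x$ until $h$ is determined by the queried values. *)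

theory Defs
  imports "HOL-Probability.Probability"
begin

text \<open>
  A Boolean function on \<open>N\<close> bits is a function \<open>('i \<Rightarrow> bool) \<Rightarrow> bool\<close> whose index type \<open>'i\<close> is
  finite with \<open>CARD('i) = N\<close>; the bit value 1 is \<open>True\<close>. The bit \<open>x\<^sup>i\<^sub>j\<close> of an input of a
  composition is \<open>x (i, j)\<close>, so the \<open>n \<cdot> m\<close> input bits are indexed by the product type.

  The minima over local witness sets, subcube partitions and algorithms are written as infima
  \<open>Inf\<close> of the corresponding sets of nonnegative reals.
\<close>

definition bool_comp ::
  "(('n \<Rightarrow> bool) \<Rightarrow> bool) \<Rightarrow> (('m \<Rightarrow> bool) \<Rightarrow> bool) \<Rightarrow> ('n \<times> 'm \<Rightarrow> bool) \<Rightarrow> bool"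
  where "bool_comp f g x = f (\<lambda>i. g (\<lambda>j. x (i, j)))"

text \<open>The product measure \<open>\<pi>\<^sub>q\<close>. The default value \<open>False\<close> is irrelevant, as the index set is
  \<open>UNIV\<close>.\<close>

definition bits_pmf :: "real \<Rightarrow> ('i::finite \<Rightarrow> bool) pmf"
  where "bits_pmf q = Pi_pmf UNIV False (\<lambda>_. bernoulli_pmf q)"

definition prob_one :: "(('i::finite \<Rightarrow> bool) \<Rightarrow> bool) \<Rightarrow> real \<Rightarrow> real"
  where "prob_one h q = measure_pmf.prob (bits_pmf q) {x. h x}"

definition cylinder :: "'i set \<Rightarrow> ('i \<Rightarrow> bool) \<Rightarrow> ('i \<Rightarrow> bool) set"
  where "cylinder W x = {y. \<forall>i\<in>W. y i = x i}"

definition determines :: "(('i \<Rightarrow> bool) \<Rightarrow> bool) \<Rightarrow> 'i set \<Rightarrow> ('i \<Rightarrow> bool) \<Rightarrow> bool"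
  where "determines h W x \<longleftrightarrow> h constant_on cylinder W x"


subsection \<open>Sensitivity\<close>

definition sensitivity_at :: "(('i \<Rightarrow> bool) \<Rightarrow> bool) \<Rightarrow> ('i \<Rightarrow> bool) \<Rightarrow> nat"
  where "sensitivity_at h x = card {i. h (x(i := \<not> x i)) \<noteq> h x}"

definition sensitivity :: "(('i::finite \<Rightarrow> bool) \<Rightarrow> bool) \<Rightarrow> real \<Rightarrow> real"
  where "sensitivity h q = measure_pmf.expectation (bits_pmf q) (\<lambda>x. real (sensitivity_at h x))"


subsection \<open>Local witness sets\<close>

text \<open>\<open>M\<close> is the underlying probability space, \<open>X\<close> the random input and \<open>I\<close> the random set.\<close>

definition random_bits_and_set ::
  "real \<Rightarrow> 'w measure \<Rightarrow> ('w \<Rightarrow> 'i::finite \<Rightarrow> bool) \<Rightarrow> ('w \<Rightarrow> 'i set) \<Rightarrow> bool"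
  where "random_bits_and_set q M X I \<longleftrightarrow>
    prob_space M \<and>
    X \<in> measurable M (count_space UNIV) \<and>
    I \<in> measurable M (count_space UNIV) \<and>
    distr M (count_space UNIV) X = measure_pmf (bits_pmf q)"

definition witness_set ::
  "(('i \<Rightarrow> bool) \<Rightarrow> bool) \<Rightarrow> 'w measure \<Rightarrow> ('w \<Rightarrow> 'i \<Rightarrow> bool) \<Rightarrow> ('w \<Rightarrow> 'i set) \<Rightarrow> bool"
  where "witness_set h M X I \<longleftrightarrow> (AE \<omega> in M. determines h (I \<omega>) (X \<omega>))"

definition local_set ::
  "'w measure \<Rightarrow> ('w \<Rightarrow> 'i \<Rightarrow> bool) \<Rightarrow> ('w \<Rightarrow> 'i set) \<Rightarrow> bool"
  where "local_set M X I \<longleftrightarrow>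
    (\<forall>J. prob_space.indep_set M
      (sigma_sets (space M)
        (insert {\<omega> \<in> space M. I \<omega> = J} ((\<lambda>i. {\<omega> \<in> space M. X \<omega> i}) ` J)))
      (sigma_sets (space M) ((\<lambda>i. {\<omega> \<in> space M. X \<omega> i}) ` (- J))))"

definition local_witness_set ::
  "(('i::finite \<Rightarrow> bool) \<Rightarrow> bool) \<Rightarrow> real \<Rightarrow> 'w measure \<Rightarrow> ('w \<Rightarrow> 'i \<Rightarrow> bool) \<Rightarrow> ('w \<Rightarrow> 'i set) \<Rightarrow> bool"
  where "local_witness_set h q M X I \<longleftrightarrow>
    random_bits_and_set q M X I \<and> witness_set h M X I \<and> local_set M X I"

definition expected_size :: "'w measure \<Rightarrow> ('w \<Rightarrow> 'i set) \<Rightarrow> real"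
  where "expected_size M I = (\<integral>\<omega>. real (card (I \<omega>)) \<partial>M)"

text \<open>
  HOL cannot quantify over the type of the sample space inside a definition, so the infimum ranges
  over all probability spaces on the type \<open>('i \<Rightarrow> bool) \<times> 'i set\<close>. This loses nothing: any
  \<open>(X, I)\<close>, on a probability space of any type, may be replaced by its joint distribution; see
  \<open>local_witness_set_canonical\<close> and \<open>local_witness_le\<close> below.
\<close>

definition local_witness :: "(('i::finite \<Rightarrow> bool) \<Rightarrow> bool) \<Rightarrow> real \<Rightarrow> real"
  where "local_witness h q =
    Inf {expected_size M I | (M :: (('i \<Rightarrow> bool) \<times> 'i set) measure) X I. local_witness_set h q M X I}"

lemma local_witness_set_canonical:
  fixes M :: "'w measure" and X :: "'w \<Rightarrow> 'i::finite \<Rightarrow> bool"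
  assumes "local_witness_set h q M X I"
  defines "M' \<equiv> distr M (count_space UNIV) (\<lambda>\<omega>. (X \<omega>, I \<omega>))"
  shows "local_witness_set h q M' fst snd" and "expected_size M' snd = expected_size M I"
proof -
  let ?Y = "\<lambda>\<omega>. (X \<omega>, I \<omega>)"
  interpret prob_space M
    using assms by (simp add: local_witness_set_def random_bits_and_set_def)
  have X[measurable]: "X \<in> measurable M (count_space UNIV)"
    and I[measurable]: "I \<in> measurable M (count_space UNIV)"
    and dX: "distr M (count_space UNIV) X = measure_pmf (bits_pmf q)"
    and wit: "AE \<omega> in M. determines h (I \<omega>) (X \<omega>)"
    and loc: "local_set M X I"
    using assms
    by (auto simp: local_witness_set_def random_bits_and_set_def witness_set_def)
  have Y[measurable]: "?Y \<in> measurable M (count_space UNIV)"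
  proof -
    have "?Y -` {z} \<inter> space M \<in> sets M" for z
    proof -
      have "?Y -` {z} \<inter> space M = (X -` {fst z} \<inter> space M) \<inter> (I -` {snd z} \<inter> space M)"
        by auto
      also have "\<dots> \<in> sets M"
        using measurable_sets[OF X] measurable_sets[OF I] by auto
      finally show ?thesis .
    qed
    then show ?thesis
      by (subst measurable_count_space_eq2) auto
  qed
  interpret M': prob_space M'
    unfolding M'_def by (rule prob_space_distr) (rule Y)
  have sp: "space M' = UNIV" and st: "sets M' = UNIV"
    by (auto simp: M'_def)
  have pre: "?Y -` B \<inter> space M \<in> sigma_sets (space M) {?Y -` A \<inter> space M |A. A \<in> G}"
    if "B \<in> sigma_sets UNIV G" for B G
    using sigma_sets_vimage_commute[of ?Y "space M" UNIV G] that by blast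
  have meas: "M'.prob B = prob (?Y -` B \<inter> space M)" for B
    unfolding M'_def by (subst measure_distr[OF Y]) auto
  have "local_set M' fst snd"
    unfolding local_set_def
  proof (intro allI M'.indep_setI)
    fix J :: "'i set" and A B
    let ?G = "insert {z :: ('i \<Rightarrow> bool) \<times> 'i set. snd z = J} ((\<lambda>i. {z. fst z i}) ` J)"
    let ?H = "(\<lambda>i. {z :: ('i \<Rightarrow> bool) \<times> 'i set. fst z i}) ` (- J)"
    assume A: "A \<in> sigma_sets (space M') (insert {\<omega> \<in> space M'. snd \<omega> = J} ((\<lambda>i. {\<omega> \<in> space M'. fst \<omega> i}) ` J))"
      and B: "B \<in> sigma_sets (space M') ((\<lambda>i. {\<omega> \<in> space M'. fst \<omega> i}) ` (- J))"
    have G: "{?Y -` A \<inter> space M |A. A \<in> ?G} =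
        insert {\<omega> \<in> space M. I \<omega> = J} ((\<lambda>i. {\<omega> \<in> space M. X \<omega> i}) ` J)"
      unfolding Setcompr_eq_image image_insert image_image by (intro arg_cong2[of _ _ _ _ insert] image_cong) auto
    have H: "{?Y -` A \<inter> space M |A. A \<in> ?H} = (\<lambda>i. {\<omega> \<in> space M. X \<omega> i}) ` (- J)"
      unfolding Setcompr_eq_image image_image by (intro image_cong) auto
    have "prob ((?Y -` A \<inter> space M) \<inter> (?Y -` B \<inter> space M)) =
        prob (?Y -` A \<inter> space M) * prob (?Y -` B \<inter> space M)"
      using loc[unfolded local_set_def, rule_format, of J, THEN indep_setD]
        pre[of A ?G, unfolded G] pre[of B ?H, unfolded H] A B
      by (simp add: sp)
    also have "(?Y -` A \<inter> space M) \<inter> (?Y -` B \<inter> space M) = ?Y -` (A \<inter> B) \<inter> space M"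
      by auto
    finally show "M'.prob (A \<inter> B) = M'.prob A * M'.prob B"
      by (simp only: meas)
  qed (simp_all add: st)
  moreover have "AE z in M'. determines h (snd z) (fst z)"
    unfolding M'_def using wit by (subst AE_distr_iff[OF Y]) auto
  moreover have "distr M' (count_space UNIV) fst = measure_pmf (bits_pmf q)"
    unfolding M'_def using Y by (subst distr_distr) (auto simp: comp_def dX)
  moreover have "fst \<in> measurable M' (count_space UNIV)" "snd \<in> measurable M' (count_space UNIV)"
    by (simp_all add: M'_def)
  ultimately show "local_witness_set h q M' fst snd"
    using M'.prob_space_axioms
    by (simp add: local_witness_set_def random_bits_and_set_def witness_set_def)
  show "expected_size M' snd = expected_size M I"
    unfolding expected_size_def M'_def by (subst integral_distr[OF Y]) auto
qed

lemma local_witness_le: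
  fixes M :: "'w measure"
  assumes "local_witness_set h q M X I"
  shows "local_witness h q \<le> expected_size M I"
  unfolding local_witness_def
proof (rule cInf_lower)
  show "bdd_below {expected_size M I | (M :: (('a \<Rightarrow> bool) \<times> 'a set) measure) X I. local_witness_set h q M X I}"
    by (rule bdd_belowI[of _ 0]) (auto simp: expected_size_def)
  show "expected_size M I \<in> {expected_size M I | (M :: (('a \<Rightarrow> bool) \<times> 'a set) measure) X I. local_witness_set h q M X I}"
    using local_witness_set_canonical(1)[OF assms] local_witness_set_canonical(2)[OF assms, symmetric]
    by blast
qed


subsection \<open>Subcube partition complexity\<close>

definition subcube :: "('i \<Rightarrow> bool) set \<Rightarrow> bool"
  where "subcube S \<longleftrightarrow> (\<exists>W z. S = cylinder W z)"

text \<open>The set \<open>W\<close> is recovered from a subcube as the set of coordinates that are constant on it.\<close>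

definition fixed_bits :: "('i \<Rightarrow> bool) set \<Rightarrow> 'i set"
  where "fixed_bits S = {i. (\<lambda>x. x i) constant_on S}"

lemma fixed_bits_cylinder: "fixed_bits (cylinder W z) = W"
proof (intro equalityI subsetI)
  fix i assume "i \<in> fixed_bits (cylinder W z)"
  then obtain c where c: "\<And>x. x \<in> cylinder W z \<Longrightarrow> x i = c"
    by (auto simp: fixed_bits_def constant_on_def)
  show "i \<in> W"
  proof (rule ccontr)
    assume "i \<notin> W"
    then have "z(i := \<not> c) \<in> cylinder W z"
      by (auto simp: cylinder_def)
    from c[OF this] show False by simp
  qed
qed (auto simp: fixed_bits_def constant_on_def cylinder_def)

definition subcube_partition :: "(('i \<Rightarrow> bool) \<Rightarrow> bool) \<Rightarrow> ('i \<Rightarrow> bool) set set \<Rightarrow> bool"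
  where "subcube_partition h C \<longleftrightarrow>
    partition_on UNIV C \<and> (\<forall>S\<in>C. subcube S \<and> h constant_on S)"

definition partition_cost :: "('i \<Rightarrow> bool) set set \<Rightarrow> ('i \<Rightarrow> bool) \<Rightarrow> nat"
  where "partition_cost C x = card (fixed_bits (THE S. S \<in> C \<and> x \<in> S))"

definition subcube_complexity :: "(('i::finite \<Rightarrow> bool) \<Rightarrow> bool) \<Rightarrow> real \<Rightarrow> real"
  where "subcube_complexity h q =
    Inf {measure_pmf.expectation (bits_pmf q) (\<lambda>x. real (partition_cost C x)) | C. subcube_partition h C}"


subsection \<open>Algorithmic complexity\<close>

text \<open>
  A query algorithm is a decision tree: \<open>Query i A B\<close> queries bit \<open>i\<close> and continues with \<open>A\<close> if its
  value is \<open>False\<close> and with \<open>B\<close> if it is \<open>True\<close>. Repeated queries are permitted and each is counted.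
\<close>

datatype 'i algorithm = Stop | Query 'i "'i algorithm" "'i algorithm"

primrec queries :: "'i algorithm \<Rightarrow> ('i \<Rightarrow> bool) \<Rightarrow> 'i list" where
  "queries Stop x = []"
| "queries (Query i A B) x = i # (if x i then queries B x else queries A x)"

definition algorithm_for :: "(('i \<Rightarrow> bool) \<Rightarrow> bool) \<Rightarrow> 'i algorithm \<Rightarrow> bool"
  where "algorithm_for h A \<longleftrightarrow> (\<forall>x. determines h (set (queries A x)) x)"

text \<open>Only the queries made until \<open>h\<close> is determined count, even if the tree goes on querying.\<close>

definition query_cost :: "(('i \<Rightarrow> bool) \<Rightarrow> bool) \<Rightarrow> 'i algorithm \<Rightarrow> ('i \<Rightarrow> bool) \<Rightarrow> nat"
  where "query_cost h A x = (LEAST k. determines h (set (take k (queries A x))) x)"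

definition algorithmic_complexity :: "(('i::finite \<Rightarrow> bool) \<Rightarrow> bool) \<Rightarrow> real \<Rightarrow> real"
  where "algorithmic_complexity h q =
    Inf {measure_pmf.expectation (bits_pmf q) (\<lambda>x. real (query_cost h A x)) | A. algorithm_for h A}"

end

theory Submission
  imports Defs
begin

text \<open>
  All four quantities are mean sizes of a set of input bits: the pivotal bits, a random witness, the
  bits fixed by a subcube, the bits read by a decision tree. In each case the set for \<open>f \<circ> g\<close> can be taken
  to be composed: a set \<open>S\<close> for \<open>f\<close> at the outer input, whose bit \<open>i\<close> is the value of \<open>g\<close> on block \<open>i\<close>, and
  for every \<open>i \<in> S\<close> a set for \<open>g\<close> inside block \<open>i\<close>. The outer bits are independent with bias
  \<open>prob_one g p\<close> (\<open>map_outer_bits\<close>), so \<open>S\<close> and the sets in the blocks have the right mean sizes. What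
  remains is that these two means multiply, although \<open>S\<close> and the sets inside the blocks are functions of
  the same input.

  They do because of a common locality property: whether \<open>i\<close> belongs to \<open>S\<close> is not influenced by the
  outer bit \<open>i\<close>. A bit is pivotal irrespective of its own value; if a subcube or a run of a decision
  tree ignores \<open>i\<close>, flipping \<open>i\<close> leaves the subcube or the run unchanged; for a local set, the
  probability of each value \<open>J\<close> that avoids \<open>i\<close> is a function of the bits in \<open>J\<close>. Hence the event \<open>i \<in> S\<close>
  depends on the other blocks, is independent of block \<open>i\<close>, and the mean of the sum over \<open>i \<in> S\<close> factors.
  This is \<open>expectation_composition\<close>. For sensitivity the composed set is the set of pivotal bits itself
  (\<open>pivotal_bool_comp\<close>), which gives equality; in the other cases it is only one candidate in the
  minimum for \<open>f \<circ> g\<close>, which gives an inequality, and passing to infima is \<open>Inf_le_mult_Inf\<close>.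

  It remains to see that the composed sets are admissible. Subcube partitions are encoded as stable
  choices of witnesses, which compose directly (\<open>stable_witness_bool_comp\<close>). Decision trees are
  composed by substitution, after removal of superfluous queries (\<open>algorithm_prune\<close>,
  \<open>queries_compose_algorithm\<close>). A local witness set is replaced by the conditional law of the set given
  the input, on which locality is a pointwise condition (\<open>witness_kernel\<close>); in this form witness sets
  compose by independent sampling (\<open>witness_kernel_compose\<close>).
\<close>

section \<open>Product measures on finite cubes\<close>

lemma expectation_finite:
  fixes u :: "'a::finite \<Rightarrow> real"
  shows "measure_pmf.expectation \<mu> u = (\<Sum>x\<in>UNIV. pmf \<mu> x * u x)"
  by (subst integral_measure_pmf[of UNIV]) auto

lemma integrable_finite_pmf [simp]:
  fixes u :: "'a::finite \<Rightarrow> real"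
  shows "integrable (measure_pmf \<mu>) u"
  by (rule integrable_measure_pmf_finite) simp

lemma expectation_bind_finite:
  fixes u :: "'b::finite \<Rightarrow> real" and \<mu> :: "'a::finite pmf"
  shows "measure_pmf.expectation (bind_pmf \<mu> K) u =
    measure_pmf.expectation \<mu> (\<lambda>x. measure_pmf.expectation (K x) u)"
  by (subst pmf_expectation_bind[of UNIV]) (auto simp: expectation_finite[of \<mu>])

lemma pmf_bits: "pmf (bits_pmf q) x = (\<Prod>i\<in>UNIV. pmf (bernoulli_pmf q) (x i))"
  by (simp add: bits_pmf_def pmf_Pi)

definition merge :: "'i set \<Rightarrow> ('i \<Rightarrow> bool) \<Rightarrow> ('i \<Rightarrow> bool) \<Rightarrow> 'i \<Rightarrow> bool"
  where "merge J x y i = (if i \<in> J then x i else y i)"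

lemma pmf_bits_merge:
  fixes x y :: "'i::finite \<Rightarrow> bool"
  shows "pmf (bits_pmf q) (merge J x y) * pmf (bits_pmf q) (merge J y x) =
    pmf (bits_pmf q) x * pmf (bits_pmf q) y"
  unfolding pmf_bits prod.distrib[symmetric] by (rule prod.cong) (auto simp: merge_def)

text \<open>
  Independence of disjoint sets of bits. Exchanging the bits in \<open>J\<close> between two independent copies
  of the input preserves their joint law and turns \<open>u x * v y\<close> into \<open>u x * v x\<close>. Dependence on the
  bits in \<open>J\<close> is only required on the support, because for \<open>q \<in> {0, 1}\<close> the objects below are
  unconstrained elsewhere.
\<close>

lemma expectation_mult_disjoint:
  fixes u v :: "('i::finite \<Rightarrow> bool) \<Rightarrow> real"
  assumes u: "\<And>x y. x \<in> set_pmf (bits_pmf q) \<Longrightarrow> y \<in> set_pmf (bits_pmf q) \<Longrightarrow>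
      (\<And>i. i \<in> J \<Longrightarrow> x i = y i) \<Longrightarrow> u x = u y"
    and v: "\<And>x y. x \<in> set_pmf (bits_pmf q) \<Longrightarrow> y \<in> set_pmf (bits_pmf q) \<Longrightarrow>
      (\<And>i. i \<notin> J \<Longrightarrow> x i = y i) \<Longrightarrow> v x = v y"
  shows "measure_pmf.expectation (bits_pmf q) (\<lambda>x. u x * v x) =
    measure_pmf.expectation (bits_pmf q) u * measure_pmf.expectation (bits_pmf q) v"
proof -
  let ?\<pi> = "pmf (bits_pmf q) :: ('i \<Rightarrow> bool) \<Rightarrow> real"
  define s where "s = (\<lambda>(x, y). (merge J x y, merge J y x))"
  define F where "F = (\<lambda>(x, y). ?\<pi> x * ?\<pi> y * (u x * v y))"
  have s: "bij_betw s UNIV UNIV"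
    by (rule bij_betw_byWitness[of _ s]) (auto simp: s_def merge_def fun_eq_iff)
  have F: "F (s (x, y)) = ?\<pi> x * ?\<pi> y * (u x * v x)" for x y
  proof (cases "?\<pi> x * ?\<pi> y = 0")
    case True
    then show ?thesis
      using pmf_bits_merge[of q J x y] by (auto simp: F_def s_def)
  next
    case False
    let ?a = "merge J x y" and ?b = "merge J y x"
    have supp: "x \<in> set_pmf (bits_pmf q)" "?a \<in> set_pmf (bits_pmf q)" "?b \<in> set_pmf (bits_pmf q)"
      using False pmf_bits_merge[of q J x y] by (auto simp: set_pmf_iff)
    have "u ?a = u x" using supp by (intro u) (auto simp: merge_def)
    moreover have "v ?b = v x" using supp by (intro v) (auto simp: merge_def)
    ultimately show ?thesis
      using pmf_bits_merge[of q J x y] by (simp add: F_def s_def)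
  qed
  have "measure_pmf.expectation (bits_pmf q) u * measure_pmf.expectation (bits_pmf q) v =
      (\<Sum>x\<in>UNIV. \<Sum>y\<in>UNIV. F (x, y))"
    by (simp add: expectation_finite sum_product F_def mult_ac)
  also have "\<dots> = (\<Sum>z\<in>UNIV. F z)"
    by (simp add: sum.cartesian_product UNIV_Times_UNIV[symmetric] del: UNIV_Times_UNIV)
  also have "\<dots> = (\<Sum>z\<in>UNIV. F (s z))"
    using sum.reindex_bij_betw[OF s, of F] by simp
  also have "\<dots> = (\<Sum>x\<in>UNIV. \<Sum>y\<in>UNIV. F (s (x, y)))"
    by (simp add: sum.cartesian_product UNIV_Times_UNIV[symmetric] del: UNIV_Times_UNIV)
  also have "\<dots> = (\<Sum>x\<in>UNIV. ?\<pi> x * (u x * v x) * (\<Sum>y\<in>UNIV. ?\<pi> y))"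
    by (simp add: F sum_distrib_left mult_ac)
  also have "(\<Sum>y\<in>UNIV. ?\<pi> y) = 1"
    by (rule sum_pmf_eq_1) auto
  finally show ?thesis
    by (simp add: expectation_finite)
qed


section \<open>Blocks of the input of a composition\<close>

definition block :: "('n \<times> 'm \<Rightarrow> bool) \<Rightarrow> 'n \<Rightarrow> 'm \<Rightarrow> bool"
  where "block y i = (\<lambda>j. y (i, j))"

definition outer :: "(('m \<Rightarrow> bool) \<Rightarrow> bool) \<Rightarrow> ('n \<times> 'm \<Rightarrow> bool) \<Rightarrow> 'n \<Rightarrow> bool"
  where "outer g y = (\<lambda>i. g (block y i))"

lemma bool_comp_outer: "bool_comp f g y = f (outer g y)"
  by (simp add: bool_comp_def outer_def block_def)

lemma outer_apply: "outer g y i = g (block y i)"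
  by (simp add: outer_def)

lemma Pi_pmf_UNIV_default:
  "Pi_pmf (UNIV :: 'i::finite set) d K = Pi_pmf UNIV d' K"
  by (rule pmf_eqI) (simp add: pmf_Pi)

lemma inj_block: "inj block"
  by (auto simp: inj_def block_def fun_eq_iff)

lemma map_block_bits:
  "map_pmf block (bits_pmf p) =
    Pi_pmf UNIV d (\<lambda>_ :: 'n::finite. bits_pmf p :: ('m::finite \<Rightarrow> bool) pmf)"
proof (rule pmf_eqI)
  fix z :: "'n \<Rightarrow> 'm \<Rightarrow> bool"
  have "z = block (\<lambda>(i, j). z i j)"
    by (simp add: block_def fun_eq_iff)
  then obtain y where z: "z = block y" by blast
  have "pmf (map_pmf block (bits_pmf p)) z = pmf (bits_pmf p) y"
    unfolding z by (rule pmf_map_inj'[OF inj_block])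
  also have "\<dots> = (\<Prod>i\<in>UNIV. \<Prod>j\<in>UNIV. pmf (bernoulli_pmf p) (y (i, j)))"
    by (simp add: pmf_bits prod.cartesian_product UNIV_Times_UNIV[symmetric] del: UNIV_Times_UNIV)
  also have "\<dots> = pmf (Pi_pmf UNIV d (\<lambda>_. bits_pmf p)) z"
    by (simp add: pmf_Pi pmf_bits z block_def)
  finally show "pmf (map_pmf block (bits_pmf p)) z = pmf (Pi_pmf UNIV d (\<lambda>_. bits_pmf p)) z" .
qed

lemma map_block_component:
  "map_pmf (\<lambda>y. block y i) (bits_pmf p) = (bits_pmf p :: ('m::finite \<Rightarrow> bool) pmf)"
  for i :: "'n::finite"
proof -
  have "map_pmf (\<lambda>y. block y i) (bits_pmf p) = map_pmf (\<lambda>z. z i) (map_pmf block (bits_pmf p))"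
    by (simp add: pmf.map_comp comp_def)
  also have "\<dots> = (bits_pmf p :: ('m \<Rightarrow> bool) pmf)"
    by (subst map_block_bits[where d = undefined]) (simp add: Pi_pmf_component)
  finally show ?thesis .
qed

lemma prob_one_bounds: "0 \<le> prob_one g p" "prob_one g p \<le> 1"
  by (simp_all add: prob_one_def)

lemma map_bits_bernoulli: "map_pmf g (bits_pmf p) = bernoulli_pmf (prob_one g p)"
proof (rule pmf_eqI)
  fix b
  have T: "pmf (map_pmf g (bits_pmf p)) True = prob_one g p"
    by (simp add: pmf_map prob_one_def vimage_def)
  have "(\<Sum>b\<in>UNIV. pmf (map_pmf g (bits_pmf p)) b) = 1"
    by (rule sum_pmf_eq_1) auto
  then have "pmf (map_pmf g (bits_pmf p)) True + pmf (map_pmf g (bits_pmf p)) False = 1"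
    by (simp add: UNIV_bool add.commute)
  with T show "pmf (map_pmf g (bits_pmf p)) b = pmf (bernoulli_pmf (prob_one g p)) b"
    by (cases b) (simp_all add: prob_one_bounds)
qed

text \<open>The blocks are independent, so their values under \<open>g\<close> are independent biased bits.\<close>

lemma map_outer_bits:
  "map_pmf (outer g) (bits_pmf p) = (bits_pmf (prob_one g p) :: ('n::finite \<Rightarrow> bool) pmf)"
  for g :: "('m::finite \<Rightarrow> bool) \<Rightarrow> bool"
proof -
  have "map_pmf (outer g) (bits_pmf p) =
      map_pmf (\<lambda>z. g \<circ> z) (map_pmf block (bits_pmf p :: ('n \<times> 'm \<Rightarrow> bool) pmf))"
    unfolding pmf.map_comp by (rule map_pmf_cong) (simp_all add: outer_def comp_def)
  also have "\<dots> = Pi_pmf UNIV (g undefined) (\<lambda>_. map_pmf g (bits_pmf p))"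
    by (subst map_block_bits[where d = undefined], subst Pi_pmf_map) auto
  also have "\<dots> = bits_pmf (prob_one g p)"
    unfolding map_bits_bernoulli bits_pmf_def[of "prob_one g p"] by (rule Pi_pmf_UNIV_default)
  finally show ?thesis .
qed

lemma expectation_outer:
  fixes u :: "('n::finite \<Rightarrow> bool) \<Rightarrow> real" and g :: "('m::finite \<Rightarrow> bool) \<Rightarrow> bool"
  shows "measure_pmf.expectation (bits_pmf p) (\<lambda>y. u (outer g y)) =
    measure_pmf.expectation (bits_pmf (prob_one g p)) u"
  unfolding map_outer_bits[symmetric] by simp

lemma expectation_block:
  fixes c :: "('m::finite \<Rightarrow> bool) \<Rightarrow> real" and i :: "'n::finite"
  shows "measure_pmf.expectation (bits_pmf p) (\<lambda>y. c (block y i)) =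
    measure_pmf.expectation (bits_pmf p) c"
proof -
  have "measure_pmf.expectation (map_pmf (\<lambda>y. block y i) (bits_pmf p)) c =
      measure_pmf.expectation (bits_pmf p) (\<lambda>y. c (block y i))"
    by simp
  then show ?thesis by (simp only: map_block_component)
qed

lemma set_outer_bits:
  "y \<in> set_pmf (bits_pmf p) \<Longrightarrow> outer g y \<in> set_pmf (bits_pmf (prob_one g p))"
  by (subst map_outer_bits[symmetric]) simp

lemma set_block_bits:
  "y \<in> set_pmf (bits_pmf p) \<Longrightarrow> block y i \<in> set_pmf (bits_pmf p)"
  using map_block_component[of i p] by (metis (no_types, lifting) imageI pmf.set_map)

text \<open>
  The identity behind all four comparisons. Choosing outer positions \<open>i\<close> with weight \<open>t i\<close> and paying
  \<open>c\<close> for each chosen block has as mean cost the product of the mean weight and the mean of \<open>c\<close>,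
  provided that the weight of \<open>i\<close> ignores the outer bit \<open>i\<close>: then \<open>t i (outer g y)\<close> is a function of
  the blocks other than \<open>i\<close>, and is independent of block \<open>i\<close>, which alone fixes the cost.
\<close>

lemma expectation_composition:
  fixes t :: "'n::finite \<Rightarrow> ('n \<Rightarrow> bool) \<Rightarrow> real" and c :: "('m::finite \<Rightarrow> bool) \<Rightarrow> real"
  assumes t: "\<And>i x x'. x \<in> set_pmf (bits_pmf (prob_one g p)) \<Longrightarrow>
      x' \<in> set_pmf (bits_pmf (prob_one g p)) \<Longrightarrow> (\<And>k. k \<noteq> i \<Longrightarrow> x k = x' k) \<Longrightarrow> t i x = t i x'"
  shows "measure_pmf.expectation (bits_pmf p) (\<lambda>y. \<Sum>i\<in>UNIV. t i (outer g y) * c (block y i)) =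
    measure_pmf.expectation (bits_pmf (prob_one g p)) (\<lambda>x. \<Sum>i\<in>UNIV. t i x) *
    measure_pmf.expectation (bits_pmf p) c"
proof -
  have "measure_pmf.expectation (bits_pmf p) (\<lambda>y. t i (outer g y) * c (block y i)) =
      measure_pmf.expectation (bits_pmf (prob_one g p)) (t i) * measure_pmf.expectation (bits_pmf p) c"
    for i
  proof -
    have "measure_pmf.expectation (bits_pmf p) (\<lambda>y. t i (outer g y) * c (block y i)) =
        measure_pmf.expectation (bits_pmf p) (\<lambda>y. t i (outer g y)) *
        measure_pmf.expectation (bits_pmf p) (\<lambda>y. c (block y i))"
    proof (rule expectation_mult_disjoint[where J = "{k. fst k \<noteq> i}"])
      fix y y' :: "'n \<times> 'm \<Rightarrow> bool"
      assume supp: "y \<in> set_pmf (bits_pmf p)" "y' \<in> set_pmf (bits_pmf p)"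
        and eq: "\<And>k. k \<in> {k. fst k \<noteq> i} \<Longrightarrow> y k = y' k"
      show "t i (outer g y) = t i (outer g y')"
        using eq by (intro t set_outer_bits supp) (simp add: outer_def block_def)
    next
      fix y y' :: "'n \<times> 'm \<Rightarrow> bool"
      assume eq: "\<And>k. k \<notin> {k. fst k \<noteq> i} \<Longrightarrow> y k = y' k"
      show "c (block y i) = c (block y' i)"
        using eq by (simp add: block_def)
    qed
    then show ?thesis
      by (simp add: expectation_outer expectation_block)
  qed
  then show ?thesis
    by (simp add: sum_distrib_right)
qed

lemma expectation_composition_set:
  fixes T :: "('n::finite \<Rightarrow> bool) \<Rightarrow> 'n set" and c :: "('m::finite \<Rightarrow> bool) \<Rightarrow> real"
  assumes T: "\<And>i x x'. (\<And>k. k \<noteq> i \<Longrightarrow> x k = x' k) \<Longrightarrow> i \<in> T x \<longleftrightarrow> i \<in> T x'"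
  shows "measure_pmf.expectation (bits_pmf p) (\<lambda>y. \<Sum>i\<in>T (outer g y). c (block y i)) =
    measure_pmf.expectation (bits_pmf (prob_one g p)) (\<lambda>x. real (card (T x))) *
    measure_pmf.expectation (bits_pmf p) c"
proof -
  have indicator: "(\<Sum>i\<in>A. w i) = (\<Sum>i\<in>UNIV. of_bool (i \<in> A) * w i)"
    for A :: "'n set" and w :: "'n \<Rightarrow> real"
    by (rule sum.mono_neutral_cong_left) auto
  have card: "real (card A) = (\<Sum>i\<in>UNIV. of_bool (i \<in> A))" for A :: "'n set"
    using indicator[of "\<lambda>_. 1" A] by simp
  show ?thesis
    unfolding indicator[where A = "T _"] card
  proof (rule expectation_composition[where t = "\<lambda>i x. of_bool (i \<in> T x)"])
    fix i :: 'n and x x' :: "'n \<Rightarrow> bool"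
    assume "\<And>k. k \<noteq> i \<Longrightarrow> x k = x' k"
    then show "of_bool (i \<in> T x) = (of_bool (i \<in> T x') :: real)"
      by (subst T[of i x x']) auto
  qed
qed


section \<open>Sensitivity\<close>

definition pivotal :: "(('i \<Rightarrow> bool) \<Rightarrow> bool) \<Rightarrow> ('i \<Rightarrow> bool) \<Rightarrow> 'i set"
  where "pivotal h x = {i. h (x(i := \<not> x i)) \<noteq> h x}"

lemma pivotal_cong:
  assumes "\<And>k. k \<noteq> i \<Longrightarrow> x k = x' k"
  shows "i \<in> pivotal h x \<longleftrightarrow> i \<in> pivotal h x'"
proof (cases "x i = x' i")
  case True
  then have "x k = x' k" for k using assms by (cases "k = i") simp_all
  then have "x = x'" by (rule ext)
  then show ?thesis by simp
next
  case False
  then have "x' = x(i := \<not> x i)" "x = x'(i := \<not> x' i)" using assms by (auto simp: fun_eq_iff)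
  then show ?thesis unfolding pivotal_def by auto
qed

text \<open>
  Flipping \<open>(i, j)\<close> changes only block \<open>i\<close>; it changes \<open>f \<circ> g\<close> iff it changes the value of \<open>g\<close> on
  that block and \<open>f\<close> is sensitive to this change.
\<close>

lemma pivotal_bool_comp:
  "pivotal (bool_comp f g) y = (SIGMA i:pivotal f (outer g y). pivotal g (block y i))"
proof -
  have "outer g (y((i, j) := \<not> y (i, j))) =
      (outer g y)(i := g ((block y i)(j := \<not> block y i j)))" for i j
    by (auto simp: outer_def block_def fun_eq_iff fun_upd_def intro!: arg_cong[of _ _ g])
  moreover have "(outer g y)(i := g (block y i)) = outer g y" for i
    by (auto simp: outer_def)
  ultimately have "(i, j) \<in> pivotal (bool_comp f g) y \<longleftrightarrow>
      i \<in> pivotal f (outer g y) \<and> j \<in> pivotal g (block y i)" for i j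
    unfolding pivotal_def bool_comp_outer mem_Collect_eq
    by (cases "g ((block y i)(j := \<not> block y i j)) = g (block y i)")
      (auto simp: outer_apply)
  then show ?thesis by auto
qed

lemma sensitivity_bool_comp:
  fixes f :: "('n::finite \<Rightarrow> bool) \<Rightarrow> bool" and g :: "('m::finite \<Rightarrow> bool) \<Rightarrow> bool"
  shows "sensitivity (bool_comp f g) p = sensitivity f (prob_one g p) * sensitivity g p"
proof -
  have s: "sensitivity_at h = (\<lambda>x. card (pivotal h x))" for h :: "('i \<Rightarrow> bool) \<Rightarrow> bool"
    by (simp add: sensitivity_at_def pivotal_def fun_eq_iff)
  have card: "real (card (pivotal (bool_comp f g) y)) =
      (\<Sum>i\<in>pivotal f (outer g y). real (card (pivotal g (block y i))))" for y
    unfolding pivotal_bool_comp by (subst card_SigmaI) simp_all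
  show ?thesis
    unfolding sensitivity_def s card
    by (rule expectation_composition_set[where T = "pivotal f"]) (rule pivotal_cong)
qed


section \<open>Witnesses of a composition and products of infima\<close>

lemma determines_alt: "determines h W x \<longleftrightarrow> (\<forall>y\<in>cylinder W x. h y = h x)"
  unfolding determines_def constant_on_def by (auto simp: cylinder_def)

lemma determines_bool_comp:
  assumes "determines f S (outer g y)"
    and "\<And>i. i \<in> S \<Longrightarrow> determines g (T i) (block y i)"
  shows "determines (bool_comp f g) (Sigma S T) y"
  unfolding determines_alt
proof
  fix y' assume y': "y' \<in> cylinder (Sigma S T) y"
  have "block y' i \<in> cylinder (T i) (block y i)" if "i \<in> S" for i
    using y' that by (simp add: cylinder_def block_def)
  then have "outer g y' i = outer g y i" if "i \<in> S" for i
    using assms(2)[OF that] that by (simp add: outer_apply determines_alt)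
  then have "outer g y' \<in> cylinder S (outer g y)"
    by (simp add: cylinder_def)
  then show "bool_comp f g y' = bool_comp f g y"
    using assms(1) by (simp add: determines_alt bool_comp_outer)
qed

lemma le_mult_Inf:
  fixes B :: "real set"
  assumes "B \<noteq> {}" and "0 \<le> a" and "\<And>b. b \<in> B \<Longrightarrow> c \<le> a * b"
  shows "c \<le> a * Inf B"
proof (cases "a = 0")
  case True
  then show ?thesis using assms by auto
next
  case False
  with assms(2) have "c / a \<le> Inf B"
    using assms(1,3) by (intro cInf_greatest) (auto simp: field_simps)
  then show ?thesis using False assms(2) by (simp add: field_simps)
qed

lemma Inf_le_mult_Inf:
  fixes A B C :: "real set"
  assumes "A \<noteq> {}" "B \<noteq> {}"
    and nonneg: "\<And>a. a \<in> A \<Longrightarrow> 0 \<le> a" "\<And>b. b \<in> B \<Longrightarrow> 0 \<le> b" "\<And>c. c \<in> C \<Longrightarrow> 0 \<le> c"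
    and prod: "\<And>a b. a \<in> A \<Longrightarrow> b \<in> B \<Longrightarrow> \<exists>c\<in>C. c \<le> a * b"
  shows "Inf C \<le> Inf A * Inf B"
proof -
  have "bdd_below C"
    using nonneg(3) by (rule bdd_belowI)
  then have "Inf C \<le> a * b" if "a \<in> A" "b \<in> B" for a b
    using prod[OF that] cInf_lower2[of _ C "a * b"] by blast
  then have "Inf C \<le> a * Inf B" if "a \<in> A" for a
    using that by (intro le_mult_Inf assms nonneg)
  then have "Inf C \<le> Inf B * Inf A"
    by (intro le_mult_Inf assms cInf_greatest nonneg) (simp_all add: mult.commute)
  then show ?thesis by (simp add: mult.commute)
qed


section \<open>Subcube partitions\<close>

text \<open>
  A subcube partition is a rule that attaches to every input \<open>x\<close> a set \<open>W x\<close> of bits to be fixed and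
  that gives the same set to all inputs agreeing with \<open>x\<close> on \<open>W x\<close>. The bits read by a decision tree
  also form such a rule.
\<close>

definition stable_witness :: "(('i \<Rightarrow> bool) \<Rightarrow> bool) \<Rightarrow> (('i \<Rightarrow> bool) \<Rightarrow> 'i set) \<Rightarrow> bool"
  where "stable_witness h W \<longleftrightarrow>
    (\<forall>x. determines h (W x) x \<and> (\<forall>y\<in>cylinder (W x) x. W y = W x))"

text \<open>
  If bit \<open>i\<close> is not in \<open>W x\<close>, stability allows it to be flipped without changing \<open>W x\<close>. Hence membership
  of \<open>i\<close> cannot depend on bit \<open>i\<close>.
\<close>

lemma stable_witness_flip:
  assumes W: "stable_witness h W" and eq: "\<And>k. k \<noteq> i \<Longrightarrow> x k = x' k"
  shows "i \<in> W x \<longleftrightarrow> i \<in> W x'"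
proof -
  have "i \<notin> W b" if "i \<notin> W a" "\<And>k. k \<noteq> i \<Longrightarrow> a k = b k" for a b
  proof -
    have "b \<in> cylinder (W a) a"
      using that by (auto simp: cylinder_def) metis+
    then show ?thesis using W that(1) by (auto simp: stable_witness_def)
  qed
  from this[of x x'] this[of x' x] eq show ?thesis by metis
qed

lemma stable_witness_expectation:
  fixes W :: "('n::finite \<Rightarrow> bool) \<Rightarrow> 'n set" and c :: "('m::finite \<Rightarrow> bool) \<Rightarrow> real"
  assumes "stable_witness f W"
  shows "measure_pmf.expectation (bits_pmf p) (\<lambda>y. \<Sum>i\<in>W (outer g y). c (block y i)) =
    measure_pmf.expectation (bits_pmf (prob_one g p)) (\<lambda>x. real (card (W x))) *
    measure_pmf.expectation (bits_pmf p) c"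
  by (rule expectation_composition_set) (rule stable_witness_flip[OF assms])

lemma stable_witness_bool_comp:
  assumes V: "stable_witness f V" and W: "stable_witness g W"
  shows "stable_witness (bool_comp f g) (\<lambda>y. SIGMA i:V (outer g y). W (block y i))"
    (is "stable_witness _ ?U")
  unfolding stable_witness_def
proof (intro allI conjI ballI)
  fix y :: "'a \<times> 'b \<Rightarrow> bool"
  show "determines (bool_comp f g) (?U y) y"
    using V W by (intro determines_bool_comp) (auto simp: stable_witness_def)
  fix y' assume y': "y' \<in> cylinder (?U y) y"
  have blocks: "block y' i \<in> cylinder (W (block y i)) (block y i)" if "i \<in> V (outer g y)" for i
    using y' that by (auto simp: cylinder_def block_def)
  have "outer g y' \<in> cylinder (V (outer g y)) (outer g y)"
    using blocks W by (auto simp: cylinder_def[of "V _"] outer_apply stable_witness_def determines_alt)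
  then have "V (outer g y') = V (outer g y)"
    using V by (auto simp: stable_witness_def)
  moreover have "W (block y' i) = W (block y i)" if "i \<in> V (outer g y)" for i
    using blocks[OF that] W by (auto simp: stable_witness_def)
  ultimately show "?U y' = ?U y" by auto
qed

lemma stable_witness_imp_subcube_partition:
  assumes W: "stable_witness h W"
  defines "C \<equiv> range (\<lambda>x. cylinder (W x) x)"
  shows "subcube_partition h C" and "partition_cost C x = card (W x)"
proof -
  have self: "x \<in> cylinder (W x) x" for x
    by (simp add: cylinder_def)
  have cell: "cylinder (W y) y = cylinder (W x) x" if x: "x \<in> cylinder (W y) y" for x y
  proof -
    have "W x = W y" using W x by (simp add: stable_witness_def)
    moreover have "cylinder (W y) y = cylinder (W y) x"
      using x by (simp add: cylinder_def)
    ultimately show ?thesis by simp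
  qed
  have "partition_on UNIV C"
  proof (rule partition_onI)
    show "\<Union>C = UNIV" using self by (auto simp: C_def)
    show "{} \<notin> C" using self by (auto simp: C_def)
    fix S T assume ST: "S \<in> C" "T \<in> C" "S \<noteq> T"
    then obtain a b where S: "S = cylinder (W a) a" and T: "T = cylinder (W b) b"
      by (auto simp: C_def)
    show "disjnt S T"
      unfolding disjnt_iff
    proof (intro allI notI)
      fix x assume "x \<in> S \<and> x \<in> T"
      then have "S = T"
        using cell[of x a] cell[of x b] by (simp add: S T)
      with ST show False by simp
    qed
  qed
  moreover have "subcube S \<and> h constant_on S" if "S \<in> C" for S
    using that W by (auto simp: C_def stable_witness_def determines_def subcube_def)
  ultimately show "subcube_partition h C"
    by (simp add: subcube_partition_def)
  have "(THE S. S \<in> C \<and> x \<in> S) = cylinder (W x) x"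
  proof (rule the_equality)
    show "cylinder (W x) x \<in> C \<and> x \<in> cylinder (W x) x" using self by (simp add: C_def)
    fix S assume S: "S \<in> C \<and> x \<in> S"
    then obtain a where a: "S = cylinder (W a) a" by (auto simp: C_def)
    with S show "S = cylinder (W x) x" using cell[of x a] by simp
  qed
  then show "partition_cost C x = card (W x)"
    by (simp add: partition_cost_def fixed_bits_cylinder)
qed

lemma subcube_partition_imp_stable_witness:
  assumes C: "subcube_partition h C"
  obtains W where "stable_witness h W" and "\<And>x. partition_cost C x = card (W x)"
proof
  define cell where "cell x = (THE S. S \<in> C \<and> x \<in> S)" for x
  have part: "partition_on UNIV C" using C by (simp add: subcube_partition_def)
  have cell_eq: "cell x = S" if "S \<in> C" "x \<in> S" for x S
    unfolding cell_def
    using that disjointD[OF partition_onD2[OF part]] by (intro the_equality) blast+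
  have cell: "cell x \<in> C \<and> x \<in> cell x" for x
    using partition_onD1[OF part] cell_eq[of _ x] by (metis UNIV_I UnionE)
  define W where "W x = fixed_bits (cell x)" for x
  have cyl: "cell x = cylinder (W x) x" for x
  proof -
    obtain V z where V: "cell x = cylinder V z"
      using C cell[of x] unfolding subcube_partition_def subcube_def by blast
    moreover have "cylinder V z = cylinder V x"
      using cell[of x] unfolding V by (auto simp: cylinder_def)
    ultimately show ?thesis by (simp add: W_def fixed_bits_cylinder)
  qed
  show "stable_witness h (\<lambda>x. fixed_bits (cell x))"
    unfolding stable_witness_def W_def[symmetric]
  proof (intro allI conjI ballI)
    fix x
    show "determines h (W x) x"
      using C cell[of x] by (simp add: determines_def subcube_partition_def flip: cyl)
    fix y assume "y \<in> cylinder (W x) x"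
    then have "cell y = cell x"
      using cell[of x] by (intro cell_eq) (simp_all add: cyl)
    then show "W y = W x" by (simp add: W_def)
  qed
  show "partition_cost C x = card (fixed_bits (cell x))" for x
    by (simp add: partition_cost_def cell_def)
qed

lemma stable_witness_UNIV: "stable_witness h (\<lambda>_. UNIV)"
proof -
  have "y = x" if "y \<in> cylinder UNIV x" for x y :: "'a \<Rightarrow> bool"
    using that by (auto simp: cylinder_def)
  then show ?thesis unfolding stable_witness_def determines_alt by blast
qed

lemma subcube_complexity_stable_witness:
  "subcube_complexity h q =
    Inf {measure_pmf.expectation (bits_pmf q) (\<lambda>x. real (card (W x))) | W. stable_witness h W}"
proof -
  have "{measure_pmf.expectation (bits_pmf q) (\<lambda>x. real (partition_cost C x)) | C. subcube_partition h C} =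
    {measure_pmf.expectation (bits_pmf q) (\<lambda>x. real (card (W x))) | W. stable_witness h W}" (is "?A = ?B")
  proof (intro equalityI subsetI)
    fix e assume "e \<in> ?A"
    then obtain C where e: "e = measure_pmf.expectation (bits_pmf q) (\<lambda>x. real (partition_cost C x))"
      and C: "subcube_partition h C" by blast
    obtain W where "stable_witness h W" "\<And>x. partition_cost C x = card (W x)"
      using subcube_partition_imp_stable_witness[OF C] by metis
    then show "e \<in> ?B" unfolding e by auto
  next
    fix e assume "e \<in> ?B"
    then obtain W where e: "e = measure_pmf.expectation (bits_pmf q) (\<lambda>x. real (card (W x)))"
      and W: "stable_witness h W" by blast
    show "e \<in> ?A"
      unfolding e stable_witness_imp_subcube_partition(2)[OF W, symmetric]
      using stable_witness_imp_subcube_partition(1)[OF W] by blast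
  qed
  then show ?thesis by (simp only: subcube_complexity_def)
qed

lemma subcube_complexity_bool_comp:
  fixes f :: "('n::finite \<Rightarrow> bool) \<Rightarrow> bool" and g :: "('m::finite \<Rightarrow> bool) \<Rightarrow> bool"
  shows "subcube_complexity (bool_comp f g) p \<le>
    subcube_complexity f (prob_one g p) * subcube_complexity g p"
  unfolding subcube_complexity_stable_witness
proof (rule Inf_le_mult_Inf, goal_cases)
  case (6 a b)
  then obtain V W where V: "stable_witness f V" and W: "stable_witness g W"
    and a: "a = measure_pmf.expectation (bits_pmf (prob_one g p)) (\<lambda>x. real (card (V x)))"
    and b: "b = measure_pmf.expectation (bits_pmf p) (\<lambda>x. real (card (W x)))"
    by blast
  have card: "real (card (SIGMA i:V (outer g y). W (block y i))) =
      (\<Sum>i\<in>V (outer g y). real (card (W (block y i))))" for y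
    by (subst card_SigmaI) simp_all
  have "a * b = measure_pmf.expectation (bits_pmf p)
      (\<lambda>y. real (card (SIGMA i:V (outer g y). W (block y i))))"
    unfolding a b card by (rule stable_witness_expectation[OF V, symmetric])
  then show ?case
    using stable_witness_bool_comp[OF V W] by auto
qed (use stable_witness_UNIV[of f] stable_witness_UNIV[of g] in \<open>blast intro: Bochner_Integration.integral_nonneg of_nat_0_le_iff\<close>)+


section \<open>Query algorithms\<close>

lemma queries_cong: "\<forall>i\<in>set (queries A x). y i = x i \<Longrightarrow> queries A y = queries A x"
  by (induction A) auto

lemma algorithm_for_stable_witness:
  assumes "algorithm_for h A"
  shows "stable_witness h (\<lambda>x. set (queries A x))"
  unfolding stable_witness_def
proof (intro allI conjI ballI)
  fix x y assume "y \<in> cylinder (set (queries A x)) x"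
  then have "queries A y = queries A x"
    by (intro queries_cong) (simp add: cylinder_def)
  then show "set (queries A y) = set (queries A x)" by simp
qed (use assms in \<open>simp add: algorithm_for_def\<close>)

lemma query_cost_le_length:
  assumes "algorithm_for h A"
  shows "query_cost h A x \<le> length (queries A x)"
  unfolding query_cost_def using assms by (intro Least_le) (simp add: algorithm_for_def)

lemma query_cost_determines:
  assumes "algorithm_for h A"
  shows "determines h (set (take (query_cost h A x) (queries A x))) x"
  unfolding query_cost_def
  by (rule LeastI[of _ "length (queries A x)"]) (use assms in \<open>simp add: algorithm_for_def\<close>)

text \<open>
  Queries whose answer is already known, and queries made after \<open>h\<close> is determined, can be removed.
  The argument \<open>W\<close> is the set of bits already read, \<open>z\<close> holds their values.
\<close>

primrec prune ::
  "(('i \<Rightarrow> bool) \<Rightarrow> bool) \<Rightarrow> 'i algorithm \<Rightarrow> 'i set \<Rightarrow> ('i \<Rightarrow> bool) \<Rightarrow> 'i algorithm" where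
  "prune h Stop W z = Stop"
| "prune h (Query i A B) W z =
    (if determines h W z then Stop
     else if i \<in> W then (if z i then prune h B W z else prune h A W z)
     else Query i (prune h A (insert i W) (z(i := False))) (prune h B (insert i W) (z(i := True))))"

lemma determines_cong:
  assumes "\<forall>i\<in>W. x i = z i"
  shows "determines h W x \<longleftrightarrow> determines h W z"
proof -
  have "cylinder W x = cylinder W z" using assms by (auto simp: cylinder_def)
  then show ?thesis by (simp add: determines_def)
qed

text \<open>
  Here \<open>k\<close> is any number of queries of \<open>A\<close> that suffices, given the answers on \<open>W\<close>; it is instantiated
  with the query cost, but has to vary in the induction, where it drops with each query of \<open>A\<close>.
\<close>

lemma prune_queries:
  assumes "\<forall>i\<in>W. x i = z i"
  shows "distinct (queries (prune h A W z) x) \<and> set (queries (prune h A W z) x) \<inter> W = {} \<and>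
    (determines h (W \<union> set (take k (queries A x))) x \<longrightarrow>
      determines h (W \<union> set (queries (prune h A W z) x)) x \<and>
      length (queries (prune h A W z) x) \<le> k)"
  using assms
proof (induction A arbitrary: W z k)
  case Stop
  then show ?case by simp
next
  case (Query i A B)
  let ?C = "if x i then B else A"
  have IH: "distinct (queries (prune h ?C V y) x) \<and> set (queries (prune h ?C V y) x) \<inter> V = {} \<and>
      (determines h (V \<union> set (take l (queries ?C x))) x \<longrightarrow>
        determines h (V \<union> set (queries (prune h ?C V y) x)) x \<and>
        length (queries (prune h ?C V y) x) \<le> l)" if "\<forall>i\<in>V. x i = y i" for V y l
    using Query.IH(1)[OF that, of l] Query.IH(2)[OF that, of l] by auto
  consider (known) "determines h W z"
    | (repeated) "\<not> determines h W z" "i \<in> W"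
    | (new) "\<not> determines h W z" "i \<notin> W"
    by blast
  then show ?case
  proof cases
    case known
    then show ?thesis using determines_cong[OF Query.prems, of h] by simp
  next
    case repeated
    then have eq: "prune h (Query i A B) W z = prune h ?C W z"
      using Query.prems by auto
    have not: "\<not> determines h W x" using repeated determines_cong[OF Query.prems, of h] by simp
    show ?thesis
    proof (cases k)
      case 0
      then show ?thesis unfolding eq using IH[OF Query.prems, of 0] not by simp
    next
      case (Suc l)
      then show ?thesis
        unfolding eq using IH[OF Query.prems, of l] repeated
        by (cases "x i") (auto simp: insert_absorb)
    qed
  next
    case new
    have not: "\<not> determines h W x" using new determines_cong[OF Query.prems, of h] by simp
    define t where "t = queries (prune h ?C (insert i W) (z(i := x i))) x"
    have eq: "queries (prune h (Query i A B) W z) x = i # t"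
      unfolding t_def using new by (cases "x i") simp_all
    have prem: "\<forall>k\<in>insert i W. x k = (z(i := x i)) k" using Query.prems by auto
    have IH': "distinct t \<and> set t \<inter> insert i W = {} \<and>
        (determines h (insert i W \<union> set (take l (queries ?C x))) x \<longrightarrow>
          determines h (insert i W \<union> set t) x \<and> length t \<le> l)" for l
      unfolding t_def by (rule IH[OF prem])
    show ?thesis
    proof (cases k)
      case 0
      then show ?thesis unfolding eq using IH'[of 0] not new by auto
    next
      case (Suc l)
      then show ?thesis unfolding eq using IH'[of l] new by auto
    qed
  qed
qed

lemma algorithm_prune:
  assumes A: "algorithm_for h A"
  obtains A' where "algorithm_for h A'" and "\<And>x. distinct (queries A' x)"
    and "\<And>x. length (queries A' x) \<le> query_cost h A x"
proof
  note P = prune_queries[of "{}" _ undefined h A, simplified]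
  show "algorithm_for h (prune h A {} undefined)"
    unfolding algorithm_for_def using P query_cost_determines[OF A] by blast
  show "distinct (queries (prune h A {} undefined) x)" for x
    using P by blast
  show "length (queries (prune h A {} undefined) x) \<le> query_cost h A x" for x
    using P query_cost_determines[OF A] by blast
qed

text \<open>
  The composed algorithm replaces each query of an outer bit \<open>i\<close> by a run of \<open>B\<close> on block \<open>i\<close>. Along the
  run, \<open>z\<close> collects the answers; the run ends with \<open>g\<close> determined, so that \<open>g z\<close> is the answer to the
  outer query whatever \<open>z\<close> contains elsewhere.
\<close>

primrec run_block ::
  "(('m \<Rightarrow> bool) \<Rightarrow> bool) \<Rightarrow> 'n \<Rightarrow> (bool \<Rightarrow> ('n \<times> 'm) algorithm) \<Rightarrow> 'm algorithm \<Rightarrow>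
    ('m \<Rightarrow> bool) \<Rightarrow> ('n \<times> 'm) algorithm" where
  "run_block g i K Stop z = K (g z)"
| "run_block g i K (Query j A B) z =
    Query (i, j) (run_block g i K A (z(j := False))) (run_block g i K B (z(j := True)))"

primrec compose_algorithm ::
  "(('m \<Rightarrow> bool) \<Rightarrow> bool) \<Rightarrow> 'm algorithm \<Rightarrow> 'n algorithm \<Rightarrow> ('n \<times> 'm) algorithm" where
  "compose_algorithm g B Stop = Stop"
| "compose_algorithm g B (Query i A0 A1) =
    run_block g i (\<lambda>b. if b then compose_algorithm g B A1 else compose_algorithm g B A0) B undefined"

lemma queries_run_block:
  "queries (run_block g i K B z) y = map (Pair i) (queries B (block y i)) @
    queries (K (g (override_on z (block y i) (set (queries B (block y i)))))) y"
proof (induction B arbitrary: z)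
  case Stop
  then show ?case by simp
next
  case (Query j A B)
  define b where "b = block y i"
  have y: "y (i, k) = b k" for k
    by (simp add: b_def block_def)
  have upd: "override_on (z(j := b j)) b S = override_on z b (insert j S)" for S
    by (auto simp: override_on_def)
  have "queries (run_block g i K (if b j then B else A) (z(j := b j))) y =
      map (Pair i) (queries (if b j then B else A) b) @
      queries (K (g (override_on (z(j := b j)) b (set (queries (if b j then B else A) b))))) y"
    unfolding b_def using Query.IH by (cases "block y i j") (simp_all only: if_True if_False)
  then show ?case
    unfolding b_def[symmetric] upd by (cases "b j") (simp_all add: y)
qed

lemma queries_compose_algorithm:
  assumes B: "algorithm_for g B"
  shows "queries (compose_algorithm g B A) y =
    concat (map (\<lambda>i. map (Pair i) (queries B (block y i))) (queries A (outer g y)))"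
proof (induction A)
  case Stop
  then show ?case by simp
next
  case (Query i A0 A1)
  have "override_on undefined (block y i) S \<in> cylinder S (block y i)" for S
    by (simp add: cylinder_def)
  then have "g (override_on undefined (block y i) (set (queries B (block y i)))) = outer g y i"
    using B unfolding algorithm_for_def determines_alt outer_apply by blast
  then show ?case
    using Query.IH by (simp add: queries_run_block)
qed

lemma algorithm_for_compose:
  assumes A: "algorithm_for f A" and B: "algorithm_for g B"
  shows "algorithm_for (bool_comp f g) (compose_algorithm g B A)"
  unfolding algorithm_for_def
proof
  fix y
  have "set (queries (compose_algorithm g B A) y) =
      (SIGMA i:set (queries A (outer g y)). set (queries B (block y i)))"
    by (auto simp: queries_compose_algorithm[OF B])
  then show "determines (bool_comp f g) (set (queries (compose_algorithm g B A) y)) y"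
    using A B by (auto simp: algorithm_for_def intro!: determines_bool_comp)
qed

lemma ex_algorithm_for:
  fixes h :: "('i::finite \<Rightarrow> bool) \<Rightarrow> bool"
  shows "\<exists>A. algorithm_for h A"
proof -
  have "\<exists>A :: 'i algorithm. \<forall>x. S \<subseteq> set (queries A x)" if "finite S" for S :: "'i set"
    using that
  proof induction
    case empty
    then show ?case by blast
  next
    case (insert i S)
    then obtain A where "\<forall>x. S \<subseteq> set (queries A x)" by blast
    then have "\<forall>x. insert i S \<subseteq> set (queries (Query i A A) x)" by auto
    then show ?case by blast
  qed
  from this[OF finite] obtain A :: "'i algorithm" where "\<forall>x. UNIV \<subseteq> set (queries A x)" by blast
  moreover have "determines h UNIV x" for x
    using stable_witness_UNIV[of h] by (simp add: stable_witness_def)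
  ultimately show ?thesis
    unfolding algorithm_for_def by (metis top.extremum_uniqueI)
qed

lemma algorithmic_complexity_bool_comp:
  fixes f :: "('n::finite \<Rightarrow> bool) \<Rightarrow> bool" and g :: "('m::finite \<Rightarrow> bool) \<Rightarrow> bool"
  shows "algorithmic_complexity (bool_comp f g) p \<le>
    algorithmic_complexity f (prob_one g p) * algorithmic_complexity g p"
  unfolding algorithmic_complexity_def
proof (rule Inf_le_mult_Inf, goal_cases)
  case (6 a b)
  then obtain A B where A: "algorithm_for f A" and B: "algorithm_for g B"
    and a: "a = measure_pmf.expectation (bits_pmf (prob_one g p)) (\<lambda>x. real (query_cost f A x))"
    and b: "b = measure_pmf.expectation (bits_pmf p) (\<lambda>x. real (query_cost g B x))"
    by blast
  obtain A' where A': "algorithm_for f A'" "\<And>x. distinct (queries A' x)"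
    and cost_A': "\<And>x. length (queries A' x) \<le> query_cost f A x"
    using algorithm_prune[OF A] by metis
  obtain B' where B': "algorithm_for g B'"
    and cost_B': "\<And>x. length (queries B' x) \<le> query_cost g B x"
    using algorithm_prune[OF B] by metis
  \<comment> \<open>Because \<open>A'\<close> never repeats a query, each block is entered at most once and the cost is a sum
    over the set of outer bits that are read.\<close>
  define D where "D = compose_algorithm g B' A'"
  have D: "algorithm_for (bool_comp f g) D"
    unfolding D_def by (rule algorithm_for_compose[OF A'(1) B'])
  have length_D: "real (length (queries D y)) =
      (\<Sum>i\<in>set (queries A' (outer g y)). real (length (queries B' (block y i))))" for y
    by (simp add: D_def queries_compose_algorithm[OF B'] length_concat comp_def
        sum_list_distinct_conv_sum_set[OF A'(2)])
  have "measure_pmf.expectation (bits_pmf p) (\<lambda>y. real (query_cost (bool_comp f g) D y)) \<le>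
      measure_pmf.expectation (bits_pmf p) (\<lambda>y. real (length (queries D y)))"
    by (intro integral_mono) (auto intro: query_cost_le_length[OF D])
  also have "\<dots> = measure_pmf.expectation (bits_pmf (prob_one g p))
        (\<lambda>x. real (card (set (queries A' x)))) *
      measure_pmf.expectation (bits_pmf p) (\<lambda>x. real (length (queries B' x)))"
    unfolding length_D by (rule stable_witness_expectation[OF algorithm_for_stable_witness[OF A'(1)]])
  also have "\<dots> \<le> a * b"
    unfolding a b distinct_card[OF A'(2)]
    by (intro mult_mono integral_mono Bochner_Integration.integral_nonneg) (auto intro: cost_A' cost_B')
  finally show ?case using D by blast
qed (use ex_algorithm_for[of f] ex_algorithm_for[of g] in \<open>blast intro: Bochner_Integration.integral_nonneg of_nat_0_le_iff\<close>)+


section \<open>Local witness sets as kernels\<close>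

text \<open>
  A local witness set is the same as a rule \<open>K\<close> that draws the set \<open>\<I>\<close> at random once the input \<open>x\<close> is
  known. Locality becomes the statement that the probability of drawing \<open>J\<close> is a function of the bits
  in \<open>J\<close> alone. Everything is required on the support of the input only.
\<close>

definition witness_kernel ::
  "(('i::finite \<Rightarrow> bool) \<Rightarrow> bool) \<Rightarrow> real \<Rightarrow> (('i \<Rightarrow> bool) \<Rightarrow> 'i set pmf) \<Rightarrow> bool"
  where "witness_kernel h q K \<longleftrightarrow>
    (\<forall>x\<in>set_pmf (bits_pmf q). \<forall>J\<in>set_pmf (K x). determines h J x) \<and>
    (\<forall>x\<in>set_pmf (bits_pmf q). \<forall>x'\<in>set_pmf (bits_pmf q). \<forall>J.
      (\<forall>i\<in>J. x i = x' i) \<longrightarrow> pmf (K x) J = pmf (K x') J)"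

definition kernel_size :: "real \<Rightarrow> (('i::finite \<Rightarrow> bool) \<Rightarrow> 'i set pmf) \<Rightarrow> real"
  where "kernel_size q K = measure_pmf.expectation (bits_pmf q)
    (\<lambda>x. measure_pmf.expectation (K x) (\<lambda>J. real (card J)))"

definition joint_pmf ::
  "real \<Rightarrow> (('i::finite \<Rightarrow> bool) \<Rightarrow> 'i set pmf) \<Rightarrow> (('i \<Rightarrow> bool) \<times> 'i set) pmf"
  where "joint_pmf q K = bind_pmf (bits_pmf q) (\<lambda>x. map_pmf (Pair x) (K x))"

lemma set_joint_pmf:
  "set_pmf (joint_pmf q K) = (SIGMA x:set_pmf (bits_pmf q). set_pmf (K x))"
  by (auto simp: joint_pmf_def)

lemma pmf_joint_pmf: "pmf (joint_pmf q K) (x, J) = pmf (bits_pmf q) x * pmf (K x) J"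
proof -
  have "pmf (map_pmf (Pair x') (K x')) (x, J) = (if x' = x then pmf (K x) J else 0)" for x'
  proof (cases "x' = x")
    case True
    then show ?thesis by (simp add: pmf_map_inj' inj_def)
  next
    case False
    then show ?thesis by (auto simp: pmf_eq_0_set_pmf)
  qed
  then show ?thesis
    by (simp add: joint_pmf_def pmf_bind expectation_finite if_distrib[of "\<lambda>a. _ * a"] cong: if_cong)
qed

lemma map_fst_joint_pmf: "map_pmf fst (joint_pmf q K) = bits_pmf q"
  by (simp add: joint_pmf_def map_bind_pmf pmf.map_comp comp_def bind_return_pmf')

lemma expectation_joint_pmf:
  fixes u :: "('i::finite \<Rightarrow> bool) \<times> 'i set \<Rightarrow> real"
  shows "measure_pmf.expectation (joint_pmf q K) u =
    measure_pmf.expectation (bits_pmf q) (\<lambda>x. measure_pmf.expectation (K x) (\<lambda>J. u (x, J)))"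
  unfolding joint_pmf_def by (subst expectation_bind_finite) simp

lemma prob_joint_pmf:
  "measure_pmf.prob (joint_pmf q K) A =
    measure_pmf.expectation (bits_pmf q) (\<lambda>x. measure_pmf.prob (K x) {J. (x, J) \<in> A})"
  for A :: "(('i::finite \<Rightarrow> bool) \<times> 'i set) set"
proof -
  have "measure_pmf.prob (K x) {J. (x, J) \<in> A} =
      measure_pmf.expectation (K x) (\<lambda>J. indicator A (x, J))" for x
  proof -
    have "(\<lambda>J. indicator A (x, J)) = (indicator {J. (x, J) \<in> A} :: _ \<Rightarrow> real)"
      by (auto simp: indicator_def)
    then show ?thesis by simp
  qed
  then show ?thesis
    using expectation_joint_pmf[of q K "indicator A"] by simp
qed

lemma sigma_local_cong:
  assumes "A \<in> sigma_sets UNIV (insert {z. snd z = J} ((\<lambda>i. {z. fst z i}) ` J))"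
  shows "(snd z = J \<longleftrightarrow> snd z' = J) \<Longrightarrow> (\<forall>i\<in>J. fst z i = fst z' i) \<Longrightarrow> z \<in> A \<longleftrightarrow> z' \<in> A"
  using assms by (induction A rule: sigma_sets.induct) auto

lemma sigma_outside_cong:
  assumes "B \<in> sigma_sets UNIV ((\<lambda>i. {z. fst z i}) ` (- J))"
  shows "(\<forall>i. i \<notin> J \<longrightarrow> fst z i = fst z' i) \<Longrightarrow> z \<in> B \<longleftrightarrow> z' \<in> B"
  using assms by (induction B rule: sigma_sets.induct) auto

text \<open>
  For an event of the \<open>\<sigma>\<close>-algebra of \<open>\<I> = J\<close> and the bits in \<open>J\<close>, the values of \<open>\<I>\<close> that realize it on
  a given input form a subset of \<open>{J}\<close> or the complement of one. So the kernel gives the event a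
  conditional probability that depends on the bits in \<open>J\<close> only.
\<close>

lemma witness_kernel_local_prob:
  assumes K: "witness_kernel h q K"
    and A: "A \<in> sigma_sets UNIV (insert {z. snd z = J} ((\<lambda>i. {z. fst z i}) ` J))"
    and x: "x \<in> set_pmf (bits_pmf q)" "x' \<in> set_pmf (bits_pmf q)" "\<forall>i\<in>J. x i = x' i"
  shows "measure_pmf.prob (K x) {I. (x, I) \<in> A} = measure_pmf.prob (K x') {I. (x', I) \<in> A}"
proof -
  define S where "S = {I. (x, I) \<in> A}"
  have S': "S = {I. (x', I) \<in> A}"
    unfolding S_def using sigma_local_cong[OF A, of "(x, _)" "(x', _)"] x(3) by auto
  have invariant: "I' \<in> S" if "I \<in> S" "I \<noteq> J" "I' \<noteq> J" for I I'
    using sigma_local_cong[OF A, of "(x, I)" "(x, I')"] that by (simp add: S_def)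
  have sub: "measure_pmf.prob (K x) T = measure_pmf.prob (K x') T" if "T \<subseteq> {J}" for T
  proof -
    have "pmf (K x) J = pmf (K x') J"
      using K x unfolding witness_kernel_def by blast
    then show ?thesis
      using subset_singletonD[OF that] by (elim disjE) (simp_all add: measure_pmf_single)
  qed
  have "measure_pmf.prob (K x) S = measure_pmf.prob (K x') S"
  proof (cases "S \<subseteq> {J}")
    case True
    then show ?thesis by (rule sub)
  next
    case False
    then obtain I where "I \<in> S" "I \<noteq> J" by auto
    then have "UNIV - S \<subseteq> {J}" using invariant[of I] by auto
    from sub[OF this] show ?thesis
      using measure_pmf.prob_compl[of S "K x"] measure_pmf.prob_compl[of S "K x'"] by simp
  qed
  then show ?thesis
    unfolding S'[symmetric] S_def[symmetric] .
qed

lemma witness_kernel_imp_local_witness_set: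
  assumes K: "witness_kernel h q K"
  shows "local_witness_set h q (measure_pmf (joint_pmf q K)) fst snd"
    and "expected_size (measure_pmf (joint_pmf q K)) snd = kernel_size q K"
proof -
  have "local_set (measure_pmf (joint_pmf q K)) fst snd"
    unfolding local_set_def
  proof (intro allI prob_space.indep_setI[OF measure_pmf.prob_space_axioms])
    fix J A B
    assume "A \<in> sigma_sets (space (joint_pmf q K)) (insert {\<omega> \<in> space (joint_pmf q K). snd \<omega> = J}
        ((\<lambda>i. {\<omega> \<in> space (joint_pmf q K). fst \<omega> i}) ` J))"
      and "B \<in> sigma_sets (space (joint_pmf q K)) ((\<lambda>i. {\<omega> \<in> space (joint_pmf q K). fst \<omega> i}) ` (- J))"
    then have A: "A \<in> sigma_sets UNIV (insert {z. snd z = J} ((\<lambda>i. {z. fst z i}) ` J))"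
      and B: "B \<in> sigma_sets UNIV ((\<lambda>i. {z. fst z i}) ` (- J))"
      by simp_all
    define b where "b x = (of_bool ((x, {}) \<in> B) :: real)" for x
    have B_iff: "(x, I) \<in> B \<longleftrightarrow> (x, {}) \<in> B" for x I
      by (rule sigma_outside_cong[OF B]) simp
    have "{I. (x, I) \<in> A \<inter> B} = (if (x, {}) \<in> B then {I. (x, I) \<in> A} else {})" for x
      using B_iff[of x] by auto
    then have AB: "measure_pmf.prob (K x) {I. (x, I) \<in> A \<inter> B} =
        measure_pmf.prob (K x) {I. (x, I) \<in> A} * b x" for x
      by (simp add: b_def)
    have "{I. (x, I) \<in> B} = (if (x, {}) \<in> B then UNIV else {})" for x
      using B_iff[of x] by auto
    then have Bb: "measure_pmf.prob (K x) {I. (x, I) \<in> B} = b x" for x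
      by (simp add: b_def)
    show "measure_pmf.prob (joint_pmf q K) (A \<inter> B) =
        measure_pmf.prob (joint_pmf q K) A * measure_pmf.prob (joint_pmf q K) B"
      unfolding prob_joint_pmf AB Bb
    proof (rule expectation_mult_disjoint[where J = J])
      fix x y assume "x \<in> set_pmf (bits_pmf q)" "y \<in> set_pmf (bits_pmf q)" "\<And>i. i \<in> J \<Longrightarrow> x i = y i"
      then show "measure_pmf.prob (K x) {I. (x, I) \<in> A} = measure_pmf.prob (K y) {I. (y, I) \<in> A}"
        by (intro witness_kernel_local_prob[OF K A]) auto
    next
      fix x y :: "'a \<Rightarrow> bool" assume "\<And>i. i \<notin> J \<Longrightarrow> x i = y i"
      then have "(x, {}) \<in> B \<longleftrightarrow> (y, {}) \<in> B"
        by (intro sigma_outside_cong[OF B]) simp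
      then show "b x = b y" by (simp add: b_def)
    qed
  qed simp_all
  moreover have "AE z in measure_pmf (joint_pmf q K). determines h (snd z) (fst z)"
    using K by (auto simp: AE_measure_pmf_iff set_joint_pmf witness_kernel_def)
  moreover have "distr (measure_pmf (joint_pmf q K)) (count_space UNIV) fst = measure_pmf (bits_pmf q)"
    using map_fst_joint_pmf[of q K] by (simp flip: map_pmf_rep_eq)
  ultimately show "local_witness_set h q (measure_pmf (joint_pmf q K)) fst snd"
    by (simp add: local_witness_set_def random_bits_and_set_def witness_set_def
        measure_pmf.prob_space_axioms)
  show "expected_size (measure_pmf (joint_pmf q K)) snd = kernel_size q K"
    by (simp add: expected_size_def kernel_size_def expectation_joint_pmf)
qed

lemma finite_prob_space_is_pmf:
  fixes M :: "'a::finite measure"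
  assumes "prob_space M" and sets: "sets M = UNIV"
  obtains P where "M = measure_pmf P"
proof
  interpret prob_space M by fact
  have "AE x in M. measure M {x} \<noteq> 0"
    unfolding AE_support_countable[OF sets] by (intro exI[of _ UNIV]) (auto intro: countable_finite)
  then show "M = measure_pmf (Abs_pmf M)"
    using assms by (subst Abs_pmf_inverse) auto
qed

lemma cylinder_in_sigma:
  fixes G :: "(('i::finite \<Rightarrow> bool) \<times> 'i set) set set"
  assumes "\<And>i. i \<in> J \<Longrightarrow> {z. fst z i} \<in> sigma_sets UNIV G"
  shows "{z. \<forall>i\<in>J. fst z i = x i} \<in> sigma_sets UNIV G"
proof -
  interpret sigma_algebra UNIV "sigma_sets UNIV G"
    by (rule sigma_algebra_sigma_sets) simp
  have "finite J" by simp
  then show ?thesis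
    using assms
  proof induction
    case empty
    then show ?case using top by simp
  next
    case (insert i J)
    have "{z. fst z i = x i} = (if x i then {z. fst z i} else UNIV - {z. fst z i})"
      by auto
    also have "\<dots> \<in> sigma_sets UNIV G"
      using insert.prems by auto
    finally have "{z. fst z i = x i} \<inter> {z. \<forall>i\<in>J. fst z i = x i} \<in> sigma_sets UNIV G"
      using insert by (intro Int) auto
    also have "{z. fst z i = x i} \<inter> {z. \<forall>i\<in>J. fst z i = x i} =
        {z :: ('i \<Rightarrow> bool) \<times> 'i set. \<forall>i\<in>insert i J. fst z i = x i}"
      by auto
    finally show ?case .
  qed
qed

text \<open>
  Conversely, a kernel is recovered by conditioning on the input. Locality makes the event that fixes
  the bits in \<open>J\<close> and \<open>\<I> = J\<close> independent of the bits outside \<open>J\<close>; for two inputs that agree on \<open>J\<close>,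
  the conditional probability of \<open>J\<close> is therefore the same quotient.
\<close>

lemma local_witness_set_imp_witness_kernel:
  fixes h :: "('i::finite \<Rightarrow> bool) \<Rightarrow> bool" and M :: "'w measure"
  assumes "local_witness_set h q M X I"
  obtains K where "witness_kernel h q K" and "kernel_size q K = expected_size M I"
proof -
  define M' where "M' = distr M (count_space UNIV) (\<lambda>\<omega>. (X \<omega>, I \<omega>))"
  have M': "local_witness_set h q M' fst snd" and size: "expected_size M' snd = expected_size M I"
    using local_witness_set_canonical[OF assms] by (simp_all add: M'_def)
  have "prob_space M'"
    using M' by (simp add: local_witness_set_def random_bits_and_set_def)
  then obtain P where P: "M' = measure_pmf P"
    by (rule finite_prob_space_is_pmf) (auto simp: M'_def)
  have fst_P: "map_pmf fst P = bits_pmf q"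
    using M' unfolding P local_witness_set_def random_bits_and_set_def
    by (simp add: map_pmf_rep_eq measure_pmf_inject[symmetric])
  have wit: "determines h (snd z) (fst z)" if "z \<in> set_pmf P" for z
    using M' that unfolding P local_witness_set_def witness_set_def by (simp add: AE_measure_pmf_iff)
  have loc: "measure_pmf.prob P (A \<inter> B) = measure_pmf.prob P A * measure_pmf.prob P B"
    if "A \<in> sigma_sets UNIV (insert {z. snd z = J} ((\<lambda>i. {z. fst z i}) ` J))"
      and "B \<in> sigma_sets UNIV ((\<lambda>i. {z. fst z i}) ` (- J))" for A B J
    using M' that unfolding P local_witness_set_def local_set_def
    by (auto dest!: spec[of _ J] intro!: prob_space.indep_setD[OF measure_pmf.prob_space_axioms])
  define K where "K x = map_pmf snd (cond_pmf P {z. fst z = x})" for x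
  have pmf_fst: "measure_pmf.prob P {z. fst z = x} = pmf (bits_pmf q) x" for x
    unfolding fst_P[symmetric] pmf_map by (rule arg_cong[where f = "measure_pmf.prob P"]) auto
  have pmf_P: "pmf P (x, J) = pmf (bits_pmf q) x * pmf (K x) J" for x J
  proof (cases "x \<in> set_pmf (bits_pmf q)")
    case True
    then have ne: "set_pmf P \<inter> {z. fst z = x} \<noteq> {}"
      unfolding fst_P[symmetric] by auto
    have "map_pmf (Pair x) (K x) = map_pmf (\<lambda>z. z) (cond_pmf P {z. fst z = x})"
      unfolding K_def pmf.map_comp by (intro map_pmf_cong) (auto simp: set_cond_pmf[OF ne])
    then have "pmf (K x) J = pmf (cond_pmf P {z. fst z = x}) (x, J)"
      using pmf_map_inj'[of "Pair x" "K x" J] by (simp add: inj_def)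
    then show ?thesis
      using True by (simp add: pmf_cond[OF ne] pmf_fst set_pmf_iff)
  next
    case False
    then have "(x, J) \<notin> set_pmf P"
      unfolding fst_P[symmetric] by force
    with False show ?thesis by (simp add: set_pmf_iff)
  qed
  have "P = joint_pmf q K"
    by (rule pmf_eqI) (auto simp: pmf_P pmf_joint_pmf)
  have "witness_kernel h q K"
    unfolding witness_kernel_def
  proof (intro conjI ballI allI impI)
    fix x J assume "x \<in> set_pmf (bits_pmf q)" "J \<in> set_pmf (K x)"
    then have "(x, J) \<in> set_pmf P"
      by (simp add: set_pmf_iff pmf_P)
    from wit[OF this] show "determines h J x" by simp
  next
    fix x x' :: "'i \<Rightarrow> bool" and J assume x: "x \<in> set_pmf (bits_pmf q)" "x' \<in> set_pmf (bits_pmf q)" "\<forall>i\<in>J. x i = x' i"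
    define E where "E = {z :: ('i \<Rightarrow> bool) \<times> 'i set. \<forall>i\<in>J. fst z i = x i}"
    define F where "F = {z :: ('i \<Rightarrow> bool) \<times> 'i set. snd z = J}"
    define D where "D y = {z :: ('i \<Rightarrow> bool) \<times> 'i set. \<forall>i\<in>- J. fst z i = y i}" for y
    have E: "E \<in> sigma_sets UNIV (insert {z. snd z = J} ((\<lambda>i. {z. fst z i}) ` J))"
      unfolding E_def by (rule cylinder_in_sigma) auto
    have F: "F \<in> sigma_sets UNIV (insert {z. snd z = J} ((\<lambda>i. {z. fst z i}) ` J))"
      unfolding F_def by auto
    have EF: "E \<inter> F \<in> sigma_sets UNIV (insert {z. snd z = J} ((\<lambda>i. {z. fst z i}) ` J))"
    proof -
      interpret sigma_algebra UNIV "sigma_sets UNIV (insert {z. snd z = J} ((\<lambda>i. {z. fst z i}) ` J))"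
        by (rule sigma_algebra_sigma_sets) simp
      show ?thesis using E F by (rule Int)
    qed
    have D: "D y \<in> sigma_sets UNIV ((\<lambda>i. {z. fst z i}) ` (- J))" for y
      unfolding D_def by (rule cylinder_in_sigma) auto
    have kernel: "pmf (K y) J = measure_pmf.prob P (E \<inter> F) / measure_pmf.prob P E"
      if y: "y \<in> set_pmf (bits_pmf q)" "\<forall>i\<in>J. x i = y i" for y
    proof -
      have E_y: "E = {z. \<forall>i\<in>J. fst z i = y i}"
        unfolding E_def using y(2) by simp
      have ED: "E \<inter> D y = {z. fst z = y}"
        unfolding E_y D_def by (auto simp: fun_eq_iff)
      then have "pmf (bits_pmf q) y = measure_pmf.prob P E * measure_pmf.prob P (D y)"
        using loc[OF E D, of y] by (simp add: pmf_fst)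
      moreover have "(E \<inter> F) \<inter> D y = {(y, J)}"
      proof -
        have "(E \<inter> F) \<inter> D y = (E \<inter> D y) \<inter> F" by (simp only: Int_ac)
        also have "\<dots> = {(y, J)}" unfolding ED F_def by (auto simp: prod_eq_iff)
        finally show ?thesis .
      qed
      then have "pmf P (y, J) = measure_pmf.prob P (E \<inter> F) * measure_pmf.prob P (D y)"
        using loc[OF EF D, of y] by (simp add: measure_pmf_single)
      moreover have "pmf (bits_pmf q) y \<noteq> 0"
        using y(1) by (simp add: set_pmf_iff)
      ultimately show ?thesis
        by (simp add: pmf_P field_simps)
    qed
    show "pmf (K x) J = pmf (K x') J"
      using kernel[of x] kernel[of x'] x by simp
  qed
  moreover from this have "kernel_size q K = expected_size M I"
    using witness_kernel_imp_local_witness_set(2)[of h q K] \<open>P = joint_pmf q K\<close> P size by simp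
  ultimately show thesis by (rule that)
qed

lemma local_witness_kernel:
  "local_witness h q = Inf {kernel_size q K | K. witness_kernel h q K}"
proof -
  have "{expected_size M I | (M :: (('a \<Rightarrow> bool) \<times> 'a set) measure) X I. local_witness_set h q M X I} =
    {kernel_size q K | K. witness_kernel h q K}" (is "?A = ?B")
  proof (intro equalityI subsetI)
    fix e assume "e \<in> ?A"
    then obtain M :: "(('a \<Rightarrow> bool) \<times> 'a set) measure" and X I
      where e: "e = expected_size M I" and MXI: "local_witness_set h q M X I" by blast
    obtain K where "witness_kernel h q K" "kernel_size q K = expected_size M I"
      using local_witness_set_imp_witness_kernel[OF MXI] .
    then show "e \<in> ?B" unfolding e by force
  next
    fix e assume "e \<in> ?B"
    then obtain K where e: "e = kernel_size q K" and K: "witness_kernel h q K" by blast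
    from witness_kernel_imp_local_witness_set[OF K] show "e \<in> ?A"
      unfolding e by force
  qed
  then show ?thesis by (simp only: local_witness_def)
qed


section \<open>Composition of local witness sets\<close>

text \<open>
  Slices outside \<open>I\<close> are fixed to be empty, so that for given \<open>I\<close> the family of slices can be recovered
  from the composed set.
\<close>

definition compose_kernel ::
  "(('m::finite \<Rightarrow> bool) \<Rightarrow> bool) \<Rightarrow> (('n::finite \<Rightarrow> bool) \<Rightarrow> 'n set pmf) \<Rightarrow>
    (('m \<Rightarrow> bool) \<Rightarrow> 'm set pmf) \<Rightarrow> ('n \<times> 'm \<Rightarrow> bool) \<Rightarrow> ('n \<times> 'm) set pmf"
  where "compose_kernel g K L y = bind_pmf (K (outer g y))
    (\<lambda>I. map_pmf (Sigma I) (Pi_pmf I {} (\<lambda>i. L (block y i))))"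

lemma pmf_map_Sigma:
  fixes Q :: "'n::finite \<Rightarrow> 'm set pmf"
  shows "pmf (map_pmf (Sigma I) (Pi_pmf I {} Q)) U =
    (if fst ` U \<subseteq> I then \<Prod>i\<in>I. pmf (Q i) (U `` {i}) else 0)"
proof (cases "fst ` U \<subseteq> I")
  case True
  have "(Sigma I S = U) \<longleftrightarrow> S = (\<lambda>i. U `` {i})" if "S \<in> set_pmf (Pi_pmf I {} Q)" for S
  proof
    assume "Sigma I S = U"
    moreover have "S i = {}" if "i \<notin> I" for i
      using set_Pi_pmf_subset[of I "{}" Q] \<open>S \<in> _\<close> that by auto
    ultimately show "S = (\<lambda>i. U `` {i})" by (auto simp: fun_eq_iff)
  next
    assume "S = (\<lambda>i. U `` {i})"
    then show "Sigma I S = U" using True by force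
  qed
  then have "measure_pmf.prob (Pi_pmf I {} Q) (Sigma I -` {U}) =
      measure_pmf.prob (Pi_pmf I {} Q) {\<lambda>i. U `` {i}}"
    by (intro measure_pmf.finite_measure_eq_AE) (simp_all add: AE_measure_pmf_iff)
  then have "pmf (map_pmf (Sigma I) (Pi_pmf I {} Q)) U = pmf (Pi_pmf I {} Q) (\<lambda>i. U `` {i})"
    by (simp add: pmf_map measure_pmf_single)
  also have "\<dots> = (\<Prod>i\<in>I. pmf (Q i) (U `` {i}))"
    using True by (subst pmf_Pi') force+
  finally show ?thesis using True by simp
next
  case False
  then show ?thesis by (auto simp: pmf_eq_0_set_pmf)
qed

text \<open>
  Locality of the composed kernel. A set \<open>U\<close> arises from an outer witness \<open>I\<close> only together with its
  slices as witnesses in the blocks of \<open>I\<close>. If these slices have positive probability, they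
  determine the outer bits in \<open>I\<close>, hence the probability of \<open>I\<close>; so each \<open>I\<close> contributes an amount that
  depends on the bits in \<open>U\<close> only. Summing over \<open>I\<close> also covers constant \<open>g\<close>, where slices may be
  empty and \<open>I\<close> cannot be read off from \<open>U\<close>.
\<close>

lemma witness_kernel_compose:
  fixes f :: "('n::finite \<Rightarrow> bool) \<Rightarrow> bool" and g :: "('m::finite \<Rightarrow> bool) \<Rightarrow> bool"
  assumes K: "witness_kernel f (prob_one g p) K" and L: "witness_kernel g p L"
  shows "witness_kernel (bool_comp f g) p (compose_kernel g K L)"
  unfolding witness_kernel_def
proof (intro conjI ballI allI impI)
  fix y :: "'n \<times> 'm \<Rightarrow> bool" and U assume y: "y \<in> set_pmf (bits_pmf p)" and "U \<in> set_pmf (compose_kernel g K L y)"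
  then obtain I S where I: "I \<in> set_pmf (K (outer g y))" and U: "U = Sigma I S"
    and S: "S \<in> set_pmf (Pi_pmf I {} (\<lambda>i. L (block y i)))"
    by (auto simp: compose_kernel_def)
  have "S i \<in> set_pmf (L (block y i))" if "i \<in> I" for i
    using S set_Pi_pmf_subset'[of I "{}" "\<lambda>i. L (block y i)"] that by (auto simp: PiE_dflt_def)
  then show "determines (bool_comp f g) U y"
    unfolding U using K L I y set_outer_bits[OF y] set_block_bits[OF y]
    by (intro determines_bool_comp) (auto simp: witness_kernel_def)
next
  fix y y' :: "'n \<times> 'm \<Rightarrow> bool" and U
  assume y: "y \<in> set_pmf (bits_pmf p)" "y' \<in> set_pmf (bits_pmf p)" and eq: "\<forall>k\<in>U. y k = y' k"
  have "pmf (K (outer g y)) I * (\<Prod>i\<in>I. pmf (L (block y i)) (U `` {i})) =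
      pmf (K (outer g y')) I * (\<Prod>i\<in>I. pmf (L (block y' i)) (U `` {i}))" for I
  proof -
    have blocks: "\<forall>j\<in>U `` {i}. block y i j = block y' i j" for i
      using eq by (auto simp: block_def)
    have slices: "pmf (L (block y i)) (U `` {i}) = pmf (L (block y' i)) (U `` {i})" for i
      using L blocks[of i] set_block_bits[OF y(1)] set_block_bits[OF y(2)]
      unfolding witness_kernel_def by blast
    show ?thesis
    proof (cases "(\<Prod>i\<in>I. pmf (L (block y i)) (U `` {i})) = 0")
      case True
      then show ?thesis by (simp add: slices)
    next
      case False
      have "outer g y i = outer g y' i" if "i \<in> I" for i
      proof -
        have "U `` {i} \<in> set_pmf (L (block y i))"
          using False that by (auto simp: set_pmf_iff)
        then have "determines g (U `` {i}) (block y i)"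
          using L set_block_bits[OF y(1)] by (simp add: witness_kernel_def)
        moreover have "block y' i \<in> cylinder (U `` {i}) (block y i)"
          using blocks[of i] by (simp add: cylinder_def)
        ultimately show ?thesis by (simp add: determines_alt outer_apply)
      qed
      then have "pmf (K (outer g y)) I = pmf (K (outer g y')) I"
        using K set_outer_bits[OF y(1)] set_outer_bits[OF y(2)] unfolding witness_kernel_def by blast
      then show ?thesis by (simp add: slices)
    qed
  qed
  then show "pmf (compose_kernel g K L y) U = pmf (compose_kernel g K L y') U"
    unfolding compose_kernel_def pmf_bind pmf_map_Sigma expectation_finite
    by (intro sum.cong) auto
qed

lemma witness_kernel_weight:
  assumes K: "witness_kernel h q K"
    and x: "x \<in> set_pmf (bits_pmf q)" "x' \<in> set_pmf (bits_pmf q)" "\<And>k. k \<noteq> i \<Longrightarrow> x k = x' k"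
  shows "measure_pmf.prob (K x) {J. i \<in> J} = measure_pmf.prob (K x') {J. i \<in> J}"
proof -
  have "measure_pmf.prob (K x) {J. i \<notin> J} = measure_pmf.prob (K x') {J. i \<notin> J}"
    unfolding measure_measure_pmf_finite[OF finite]
  proof (rule sum.cong)
    fix J assume "J \<in> {J. i \<notin> J}"
    then have "x k = x' k" if "k \<in> J" for k
      using that by (intro x(3)) auto
    then show "pmf (K x) J = pmf (K x') J"
      using K x(1,2) unfolding witness_kernel_def by blast
  qed simp
  moreover have "{J. i \<notin> J} = UNIV - {J. i \<in> J}" by auto
  ultimately show ?thesis
    using measure_pmf.prob_compl[of "{J. i \<in> J}" "K x"] measure_pmf.prob_compl[of "{J. i \<in> J}" "K x'"]
    by simp
qed

lemma expectation_card_compose_kernel: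
  "measure_pmf.expectation (compose_kernel g K L y) (\<lambda>U. real (card U)) =
    (\<Sum>i\<in>UNIV. measure_pmf.prob (K (outer g y)) {I. i \<in> I} *
      measure_pmf.expectation (L (block y i)) (\<lambda>J. real (card J)))"
proof -
  let ?c = "\<lambda>i. measure_pmf.expectation (L (block y i)) (\<lambda>J. real (card J))"
  let ?P = "\<lambda>I. Pi_pmf I {} (\<lambda>i. L (block y i))"
  have slice: "measure_pmf.expectation (?P I) (\<lambda>S. real (card (S i))) = ?c i" if "i \<in> I" for I i
  proof -
    have "measure_pmf.expectation (map_pmf (\<lambda>S. S i) (?P I)) (\<lambda>J. real (card J)) = ?c i"
      using that by (subst Pi_pmf_component) simp_all
    then show ?thesis by simp
  qed
  have inner: "measure_pmf.expectation (map_pmf (Sigma I) (?P I)) (\<lambda>U. real (card U)) =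
      (\<Sum>i\<in>UNIV. indicator {I. i \<in> I} I * ?c i)" for I
  proof -
    have "measure_pmf.expectation (map_pmf (Sigma I) (?P I)) (\<lambda>U. real (card U)) =
        measure_pmf.expectation (?P I) (\<lambda>S. \<Sum>i\<in>I. real (card (S i)))"
      by (simp add: card_SigmaI)
    also have "\<dots> = (\<Sum>i\<in>I. ?c i)"
      by (subst Bochner_Integration.integral_sum) (simp_all add: slice)
    also have "\<dots> = (\<Sum>i\<in>UNIV. indicator {I. i \<in> I} I * ?c i)"
      by (rule sum.mono_neutral_cong_left) auto
    finally show ?thesis .
  qed
  have "measure_pmf.expectation (compose_kernel g K L y) (\<lambda>U. real (card U)) =
      measure_pmf.expectation (K (outer g y)) (\<lambda>I. \<Sum>i\<in>UNIV. indicator {I. i \<in> I} I * ?c i)"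
    unfolding compose_kernel_def expectation_bind_finite inner ..
  also have "\<dots> = (\<Sum>i\<in>UNIV. measure_pmf.prob (K (outer g y)) {I. i \<in> I} * ?c i)"
    by (subst Bochner_Integration.integral_sum) simp_all
  finally show ?thesis .
qed

lemma kernel_size_compose:
  fixes f :: "('n::finite \<Rightarrow> bool) \<Rightarrow> bool" and g :: "('m::finite \<Rightarrow> bool) \<Rightarrow> bool"
  assumes K: "witness_kernel f (prob_one g p) K"
  shows "kernel_size p (compose_kernel g K L) = kernel_size (prob_one g p) K * kernel_size p L"
proof -
  have size: "(\<Sum>i\<in>UNIV. measure_pmf.prob (K x) {I. i \<in> I}) =
      measure_pmf.expectation (K x) (\<lambda>I. real (card I))" for x
  proof -
    have "(\<lambda>I. real (card I)) = (\<lambda>I. \<Sum>i\<in>UNIV. indicator {I. i \<in> I} (I :: 'n set))"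
      by (simp add: indicator_def sum.If_cases fun_eq_iff)
    then show ?thesis by simp
  qed
  show ?thesis
    unfolding kernel_size_def expectation_card_compose_kernel size[symmetric]
    by (rule expectation_composition[where t = "\<lambda>i x. measure_pmf.prob (K x) {I. i \<in> I}"])
      (rule witness_kernel_weight[OF K])
qed

lemma local_witness_bool_comp:
  fixes f :: "('n::finite \<Rightarrow> bool) \<Rightarrow> bool" and g :: "('m::finite \<Rightarrow> bool) \<Rightarrow> bool"
  shows "local_witness (bool_comp f g) p \<le> local_witness f (prob_one g p) * local_witness g p"
  unfolding local_witness_kernel
proof (rule Inf_le_mult_Inf, goal_cases)
  case 1
  have "witness_kernel f (prob_one g p) (\<lambda>_. return_pmf UNIV)"
    using stable_witness_UNIV[of f] by (auto simp: witness_kernel_def stable_witness_def indicator_def)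
  then show ?case by blast
next
  case 2
  have "witness_kernel g p (\<lambda>_. return_pmf UNIV)"
    using stable_witness_UNIV[of g] by (auto simp: witness_kernel_def stable_witness_def indicator_def)
  then show ?case by blast
next
  case (6 a b)
  then obtain K L where K: "witness_kernel f (prob_one g p) K" and L: "witness_kernel g p L"
    and ab: "a = kernel_size (prob_one g p) K" "b = kernel_size p L"
    by blast
  show ?case
    using witness_kernel_compose[OF K L] kernel_size_compose[OF K, of L] unfolding ab by force
qed (auto simp: kernel_size_def intro!: Bochner_Integration.integral_nonneg)


section \<open>The four composition bounds\<close>

theorem proposition3p2:
  fixes f :: "('n::finite \<Rightarrow> bool) \<Rightarrow> bool"
    and g :: "('m::finite \<Rightarrow> bool) \<Rightarrow> bool"
    and p :: real
  assumes "0 \<le> p" and "p \<le> 1"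
  shows "sensitivity (bool_comp f g) p = sensitivity f (prob_one g p) * sensitivity g p
    \<and> local_witness (bool_comp f g) p \<le> local_witness f (prob_one g p) * local_witness g p
    \<and> subcube_complexity (bool_comp f g) p
        \<le> subcube_complexity f (prob_one g p) * subcube_complexity g p
    \<and> algorithmic_complexity (bool_comp f g) p
        \<le> algorithmic_complexity f (prob_one g p) * algorithmic_complexity g p"
  by (intro conjI sensitivity_bool_comp local_witness_bool_comp subcube_complexity_bool_comp
      algorithmic_complexity_bool_comp)

end
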